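(* Let $A$ be an $\mathbb S_n$-stable subgroup of $(\mathbb Z/2)^n$ containing $\alpha=(1,1,\dots,1)$, let $G=A\rtimes\mathbb S_n$, $\tau\in\mathbb S_n$ and $\sigma=(\alpha,\tau)\in G$. Then $G^\sigma=G^\tau=A^\tau\rtimes\mathbb S_n^\tau$; let $\rho=\theta_{\chi,\mu}\in\widehat{G^\sigma}$ with $\chi\in\widehat{A^\tau}$ and $\mu\in\widehat{(\mathbb S_n^\tau)_\chi}$. Then: (i) $\mathcal O_{(\alpha,\tau)}^G=\alpha\,\mathcal O_{(0,\tau)}^G$. (ii) If $H$ is a group, $\sigma'\in H$ and $a\in Z(H)$ (the center of $H$), then $\mathcal O_{\sigma'}^H$ is a rack of type $D$ if and only if $a\,\mathcal O_{\sigma'}^H$ is a rack of type $D$. (iii) If $\chi(\alpha)=1$, then $\dim\mathfrak B(\mathcal O_{(\alpha,\tau)}^G,\rho)<\infty$ if and only if $\dim\mathfrak B(\mathcal O_{(0,\tau)}^G,\rho)<\infty$. (iv) If $\chi(\alpha)=-1$, then it is impossible that $\mathfrak B(\mathcal O_{(\alpha,\tau)}^G,\rho)$ and $\mathfrak B(\mathcal O_{(0,\tau)}^G,\rho)$ are both finite dimensional.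
   Context: Group. $\mathbb S_n$ acts on $(\mathbb Z/2)^n$ (additive) by $(h\cdot a)_i=a_{h^{-1}(i)}$; $G=A\rtimes\mathbb S_n$ has product $(a,\sigma)(b,\tau)=(a+\sigma\cdot b,\sigma\tau)$, and $A,\mathbb S_n$ are viewed as subgroups. Representations. $A^\tau=\{a\in A:\tau\cdot a=a\}$, $(\mathbb S_n^\tau)_\chi$ is the stabilizer of $\chi$ in $\mathbb S_n^\tau$, and $\theta_{\chi,\mu}$ is the representation of $G^\tau$ induced from $\chi\otimes\mu$ on $A^\tau\rtimes(\mathbb S_n^\tau)_\chi$. Every irreducible representation of $G^\tau$ has this form. Nichols algebras. For a finite group $G$ and $s\in G$, $G^s$ is the centralizer, $\mathcal O_s^G$ the conjugacy class, $\widehat G$ the set of isomorphism classes of irreducible complex representations. For $(\rho,V)\in\widehat{G^s}$, $M(\mathcal O_s^G,\rho)$ is the Yetter-Drinfeld module $\mathbb CG\otimes_{\mathbb CG^s}V$ with the induced action and coaction $\delta(h\otimes v)=hsh^{-1}\otimes(h\otimes v)$; the braiding is $c(x\otimes y)=x_{(-1)}\cdot y\otimes x_{(0)}$, $\mathfrak B(M)$ is the Nichols algebra of $M$, and $\mathfrak B(\mathcal O_s^G,\rho)=\mathfrak B(M(\mathcal O_s^G,\rho))$. Racks. A conjugation-stable subset of a group is a rack under $x\rhd y=xyx^{-1}$. A rack $X$ is of type $D$ if it contains a subrack $Y=R\sqcup S$ that is decomposable (a disjoint union of nonempty subracks $R,S$ with $R\rhd S=S$ and $S\rhd R=R$) and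 there exist $r\in R$, $s\in S$ with $r\rhd(s\rhd(r\rhd s))\neq s$. Groups are finite. *)

theory Defs
  imports Complex_Main "HOL-Algebra.Algebra" "HOL-Library.Z2" "HOL-Library.Function_Algebras"
begin

section \<open>The groups $A \rtimes P$\<close>

text \<open>Vectors of $(\mathbb Z/2)^n$ are functions \<^typ>\<open>nat \<Rightarrow> bit\<close> vanishing outside $\{1,\dots,n\}$,
  the index set on which \<^const>\<open>sym_group\<close> acts.\<close>

definition bit_vectors :: "nat \<Rightarrow> (nat \<Rightarrow> bit) monoid" where
  "bit_vectors n = \<lparr>carrier = {a. \<forall>i. i \<notin> {1..n} \<longrightarrow> a i = 0}, monoid.mult = (+), one = 0\<rparr>"

definition perm_act :: "(nat \<Rightarrow> nat) \<Rightarrow> (nat \<Rightarrow> bit) \<Rightarrow> (nat \<Rightarrow> bit)" where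
  "perm_act h a = (\<lambda>i. a (inv' h i))"

definition all_ones :: "nat \<Rightarrow> (nat \<Rightarrow> bit)" where
  "all_ones n = (\<lambda>i. if i \<in> {1..n} then 1 else 0)"

definition perm_stable :: "nat \<Rightarrow> (nat \<Rightarrow> bit) set \<Rightarrow> bool" where
  "perm_stable n A \<longleftrightarrow> (\<forall>h\<in>carrier (sym_group n). \<forall>a\<in>A. perm_act h a \<in> A)"

definition semidirect ::
    "(nat \<Rightarrow> bit) set \<Rightarrow> (nat \<Rightarrow> nat) set \<Rightarrow> ((nat \<Rightarrow> bit) \<times> (nat \<Rightarrow> nat)) monoid" where
  "semidirect A P =
    \<lparr>carrier = A \<times> P,
     monoid.mult = (\<lambda>(a, s) (b, t). (a + perm_act s b, s \<circ> t)),
     one = (0, id)\<rparr>"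

definition centralizer :: "'g monoid \<Rightarrow> 'g \<Rightarrow> 'g monoid" where
  "centralizer G s = G\<lparr>carrier := {g \<in> carrier G. g \<otimes>\<^bsub>G\<^esub> s = s \<otimes>\<^bsub>G\<^esub> g}\<rparr>"

definition center :: "'g monoid \<Rightarrow> 'g set" where
  "center G = {z \<in> carrier G. \<forall>g\<in>carrier G. z \<otimes>\<^bsub>G\<^esub> g = g \<otimes>\<^bsub>G\<^esub> z}"

definition conj_by :: "'g monoid \<Rightarrow> 'g \<Rightarrow> 'g \<Rightarrow> 'g" where
  "conj_by G x y = x \<otimes>\<^bsub>G\<^esub> y \<otimes>\<^bsub>G\<^esub> inv\<^bsub>G\<^esub> x"

definition conj_class :: "'g monoid \<Rightarrow> 'g \<Rightarrow> 'g set" where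
  "conj_class G s = (\<lambda>h. conj_by G h s) ` carrier G"

definition fixed_vectors :: "(nat \<Rightarrow> bit) set \<Rightarrow> (nat \<Rightarrow> nat) \<Rightarrow> (nat \<Rightarrow> bit) set" where
  "fixed_vectors A \<tau> = {a \<in> A. perm_act \<tau> a = a}"


section \<open>Racks of type D\<close>

definition rack :: "'a set \<Rightarrow> ('a \<Rightarrow> 'a \<Rightarrow> 'a) \<Rightarrow> bool" where
  "rack Q opr \<longleftrightarrow>
    (\<forall>x\<in>Q. bij_betw (opr x) Q Q) \<and>
    (\<forall>x\<in>Q. \<forall>y\<in>Q. \<forall>z\<in>Q. opr x (opr y z) = opr (opr x y) (opr x z))"

definition rack_image :: "('a \<Rightarrow> 'a \<Rightarrow> 'a) \<Rightarrow> 'a set \<Rightarrow> 'a set \<Rightarrow> 'a set" where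
  "rack_image opr R S = (\<Union>r\<in>R. opr r ` S)"

definition rack_type_D :: "'a set \<Rightarrow> ('a \<Rightarrow> 'a \<Rightarrow> 'a) \<Rightarrow> bool" where
  "rack_type_D Q opr \<longleftrightarrow> rack Q opr \<and>
    (\<exists>R S. R \<union> S \<subseteq> Q \<and> rack (R \<union> S) opr \<and>
      R \<noteq> {} \<and> S \<noteq> {} \<and> R \<inter> S = {} \<and> rack R opr \<and> rack S opr \<and>
      rack_image opr R S = S \<and> rack_image opr S R = R \<and>
      (\<exists>r\<in>R. \<exists>s\<in>S. opr r (opr s (opr r s)) \<noteq> s))"


section \<open>Complex representations\<close>

text \<open>Every complex vector space is isomorphic to a space of functions on some set.  All vector
  spaces are therefore taken to be linear subspaces of function spaces \<^typ>\<open>'i \<Rightarrow> complex\<close> with the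
  pointwise operations; tensor products are then spaces of functions of several variables.\<close>

definition cscale :: "complex \<Rightarrow> ('i \<Rightarrow> complex) \<Rightarrow> ('i \<Rightarrow> complex)" where
  "cscale c f = (\<lambda>i. c * f i)"

global_interpretation cfun: vector_space cscale
  by standard (auto simp: cscale_def fun_eq_iff algebra_simps)

definition linear_map_on :: "('i \<Rightarrow> complex) set \<Rightarrow> (('i \<Rightarrow> complex) \<Rightarrow> ('j \<Rightarrow> complex)) \<Rightarrow> bool" where
  "linear_map_on V f \<longleftrightarrow>
    (\<forall>u\<in>V. \<forall>v\<in>V. f (u + v) = f u + f v) \<and> (\<forall>c. \<forall>v\<in>V. f (cscale c v) = cscale c (f v))"

definition representation ::
    "'g monoid \<Rightarrow> ('i \<Rightarrow> complex) set \<Rightarrow> ('g \<Rightarrow> ('i \<Rightarrow> complex) \<Rightarrow> ('i \<Rightarrow> complex)) \<Rightarrow> bool" where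
  "representation G V \<rho> \<longleftrightarrow> cfun.subspace V \<and>
    (\<forall>g\<in>carrier G. linear_map_on V (\<rho> g) \<and> \<rho> g ` V \<subseteq> V) \<and>
    (\<forall>v\<in>V. \<rho> \<one>\<^bsub>G\<^esub> v = v) \<and>
    (\<forall>g\<in>carrier G. \<forall>h\<in>carrier G. \<forall>v\<in>V. \<rho> (g \<otimes>\<^bsub>G\<^esub> h) v = \<rho> g (\<rho> h v))"

definition irreducible_rep ::
    "'g monoid \<Rightarrow> ('i \<Rightarrow> complex) set \<Rightarrow> ('g \<Rightarrow> ('i \<Rightarrow> complex) \<Rightarrow> ('i \<Rightarrow> complex)) \<Rightarrow> bool" where
  "irreducible_rep G V \<rho> \<longleftrightarrow> representation G V \<rho> \<and> V \<noteq> {0} \<and>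
    (\<forall>U. cfun.subspace U \<and> U \<subseteq> V \<and> (\<forall>g\<in>carrier G. \<rho> g ` U \<subseteq> U) \<longrightarrow> U = {0} \<or> U = V)"

definition rep_iso ::
    "'g monoid \<Rightarrow> ('i \<Rightarrow> complex) set \<Rightarrow> ('g \<Rightarrow> ('i \<Rightarrow> complex) \<Rightarrow> ('i \<Rightarrow> complex)) \<Rightarrow>
      ('j \<Rightarrow> complex) set \<Rightarrow> ('g \<Rightarrow> ('j \<Rightarrow> complex) \<Rightarrow> ('j \<Rightarrow> complex)) \<Rightarrow> bool" where
  "rep_iso G V \<rho> W \<pi> \<longleftrightarrow>
    (\<exists>T. linear_map_on V T \<and> bij_betw T V W \<and> (\<forall>g\<in>carrier G. \<forall>v\<in>V. T (\<rho> g v) = \<pi> g (T v)))"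

text \<open>The irreducible representations of an abelian group, up to isomorphism.\<close>

definition linear_character :: "'g monoid \<Rightarrow> ('g \<Rightarrow> complex) \<Rightarrow> bool" where
  "linear_character G \<chi> \<longleftrightarrow> \<chi> \<in> hom G \<lparr>carrier = - {0}, monoid.mult = (*), one = 1\<rparr>"

text \<open>For a representation \<open>(V, \<rho>)\<close> of a subgroup $K$ of a finite group $G$, the induced module
  $\mathbb C G \otimes_{\mathbb C K} V$ is the space of $f : G \to V$ with
  $f(gk) = \rho(k^{-1}) f(g)$, on which $x \in G$ acts by $(x \cdot f)(g) = f(x^{-1} g)$.  The tensor
  $h \otimes v$ is the function supported on $hK$ with $hk \mapsto \rho(k^{-1})v$
  (\<open>ind_tensor\<close>).  A function $G \to V \subseteq \mathbb C^I$ is uncurried to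
  $G \times I \to \mathbb C$.\<close>

definition ind_space ::
    "'g monoid \<Rightarrow> 'g monoid \<Rightarrow> ('i \<Rightarrow> complex) set \<Rightarrow>
      ('g \<Rightarrow> ('i \<Rightarrow> complex) \<Rightarrow> ('i \<Rightarrow> complex)) \<Rightarrow> ('g \<times> 'i \<Rightarrow> complex) set" where
  "ind_space G K V \<rho> = {f.
    (\<forall>g\<in>carrier G. (\<lambda>i. f (g, i)) \<in> V) \<and>
    (\<forall>g. g \<notin> carrier G \<longrightarrow> (\<forall>i. f (g, i) = 0)) \<and>
    (\<forall>g\<in>carrier G. \<forall>k\<in>carrier K.
      (\<lambda>i. f (g \<otimes>\<^bsub>G\<^esub> k, i)) = \<rho> (inv\<^bsub>G\<^esub> k) (\<lambda>i. f (g, i)))}"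

definition ind_act :: "'g monoid \<Rightarrow> 'g \<Rightarrow> ('g \<times> 'i \<Rightarrow> complex) \<Rightarrow> ('g \<times> 'i \<Rightarrow> complex)" where
  "ind_act G x f = (\<lambda>(g, i). if g \<in> carrier G then f (inv\<^bsub>G\<^esub> x \<otimes>\<^bsub>G\<^esub> g, i) else 0)"

definition ind_tensor ::
    "'g monoid \<Rightarrow> 'g monoid \<Rightarrow> ('g \<Rightarrow> ('i \<Rightarrow> complex) \<Rightarrow> ('i \<Rightarrow> complex)) \<Rightarrow>
      'g \<Rightarrow> ('i \<Rightarrow> complex) \<Rightarrow> ('g \<times> 'i \<Rightarrow> complex)" where
  "ind_tensor G K \<rho> h v =
    (\<lambda>(g, i). if g \<in> carrier G \<and> inv\<^bsub>G\<^esub> h \<otimes>\<^bsub>G\<^esub> g \<in> carrier K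
      then \<rho> (inv\<^bsub>G\<^esub> (inv\<^bsub>G\<^esub> h \<otimes>\<^bsub>G\<^esub> g)) v i else 0)"

context
  fixes G :: "'g monoid" and K :: "'g set"
    and V :: "('i \<Rightarrow> complex) set" and \<rho> :: "'g \<Rightarrow> ('i \<Rightarrow> complex) \<Rightarrow> ('i \<Rightarrow> complex)"
  assumes G: "group G" and K: "subgroup K G" and \<rho>: "representation (G\<lparr>carrier := K\<rparr>) V \<rho>"
begin

interpretation group G by (fact G)
interpretation K: subgroup K G by (fact K)

lemma ind_tensor_in_ind_space:
  assumes h: "h \<in> carrier G" and v: "v \<in> V"
  shows "ind_tensor G (G\<lparr>carrier := K\<rparr>) \<rho> h v \<in> ind_space G (G\<lparr>carrier := K\<rparr>) V \<rho>"
proof -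
  have V: "cfun.subspace V" and im: "\<And>k u. k \<in> K \<Longrightarrow> u \<in> V \<Longrightarrow> \<rho> k u \<in> V"
    and mult: "\<And>k l u. k \<in> K \<Longrightarrow> l \<in> K \<Longrightarrow> u \<in> V \<Longrightarrow> \<rho> (k \<otimes>\<^bsub>G\<^esub> l) u = \<rho> k (\<rho> l u)"
    and lin: "\<And>k. k \<in> K \<Longrightarrow> linear_map_on V (\<rho> k)"
    using \<rho> by (auto simp: representation_def)
  have 0: "0 \<in> V" using V by (rule cfun.subspace_0)
  have z: "\<rho> k (\<lambda>i. 0) = 0" if "k \<in> K" for k
  proof -
    have "\<rho> k (cscale 0 0) = cscale 0 (\<rho> k 0)" using lin[OF that] 0 unfolding linear_map_on_def by blast
    moreover have "cscale 0 (0 :: 'i \<Rightarrow> complex) = (\<lambda>i. 0)" by (auto simp: cscale_def)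
    ultimately show ?thesis by (auto simp: cscale_def fun_eq_iff)
  qed
  have mem: "inv\<^bsub>G\<^esub> h \<otimes>\<^bsub>G\<^esub> (g \<otimes>\<^bsub>G\<^esub> k) \<in> K \<longleftrightarrow> inv\<^bsub>G\<^esub> h \<otimes>\<^bsub>G\<^esub> g \<in> K" if "g \<in> carrier G" "k \<in> K" for g k
  proof -
    have kc: "k \<in> carrier G" using that K.mem_carrier by blast
    have e: "inv\<^bsub>G\<^esub> h \<otimes>\<^bsub>G\<^esub> (g \<otimes>\<^bsub>G\<^esub> k) = (inv\<^bsub>G\<^esub> h \<otimes>\<^bsub>G\<^esub> g) \<otimes>\<^bsub>G\<^esub> k" using h that kc by (simp add: m_assoc)
    have "(inv\<^bsub>G\<^esub> h \<otimes>\<^bsub>G\<^esub> g) = (inv\<^bsub>G\<^esub> h \<otimes>\<^bsub>G\<^esub> g) \<otimes>\<^bsub>G\<^esub> k \<otimes>\<^bsub>G\<^esub> inv\<^bsub>G\<^esub> k" using h that kc by (simp add: m_assoc)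
    then show ?thesis using e that by (metis K.m_closed K.m_inv_closed)
  qed
  have val: "(\<lambda>i. ind_tensor G (G\<lparr>carrier := K\<rparr>) \<rho> h v (g, i)) =
      (if inv\<^bsub>G\<^esub> h \<otimes>\<^bsub>G\<^esub> g \<in> K then \<rho> (inv\<^bsub>G\<^esub> (inv\<^bsub>G\<^esub> h \<otimes>\<^bsub>G\<^esub> g)) v else 0)" if "g \<in> carrier G" for g
    using that by (auto simp: ind_tensor_def)
  show ?thesis unfolding ind_space_def
  proof (intro CollectI conjI ballI allI impI)
    fix g assume "g \<in> carrier G"
    then show "(\<lambda>i. ind_tensor G (G\<lparr>carrier := K\<rparr>) \<rho> h v (g, i)) \<in> V"
      using 0 im v by (simp add: val)
  next
    fix g i assume "g \<notin> carrier G"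
    then show "ind_tensor G (G\<lparr>carrier := K\<rparr>) \<rho> h v (g, i) = 0"
      by (simp add: ind_tensor_def)
  next
    fix g k assume g: "g \<in> carrier G" and "k \<in> carrier (G\<lparr>carrier := K\<rparr>)"
    then have k: "k \<in> K" by simp
    have kc: "k \<in> carrier G" using k K.mem_carrier by blast
    have i: "inv\<^bsub>G\<^esub> (inv\<^bsub>G\<^esub> h \<otimes>\<^bsub>G\<^esub> (g \<otimes>\<^bsub>G\<^esub> k)) = inv\<^bsub>G\<^esub> k \<otimes>\<^bsub>G\<^esub> inv\<^bsub>G\<^esub> (inv\<^bsub>G\<^esub> h \<otimes>\<^bsub>G\<^esub> g)"
      using h g kc by (simp add: inv_mult_group m_assoc)
    have m: "\<rho> (inv\<^bsub>G\<^esub> k \<otimes>\<^bsub>G\<^esub> inv\<^bsub>G\<^esub> (inv\<^bsub>G\<^esub> h \<otimes>\<^bsub>G\<^esub> g)) v = \<rho> (inv\<^bsub>G\<^esub> k) (\<rho> (inv\<^bsub>G\<^esub> (inv\<^bsub>G\<^esub> h \<otimes>\<^bsub>G\<^esub> g)) v)"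
      if "inv\<^bsub>G\<^esub> h \<otimes>\<^bsub>G\<^esub> g \<in> K"
      using mult k that v by blast
    have z': "\<rho> (inv\<^bsub>G\<^esub> k) 0 = 0" using z[of "inv\<^bsub>G\<^esub> k"] k by (simp add: zero_fun_def)
    have gk: "g \<otimes>\<^bsub>G\<^esub> k \<in> carrier G" using g kc by simp
    show "(\<lambda>i. ind_tensor G (G\<lparr>carrier := K\<rparr>) \<rho> h v (g \<otimes>\<^bsub>G\<^esub> k, i)) = \<rho> (inv\<^bsub>G\<^esub> k) (\<lambda>i. ind_tensor G (G\<lparr>carrier := K\<rparr>) \<rho> h v (g, i))"
      unfolding val[OF gk] val[OF g] mem[OF g k] i using m z' by simp
  qed
qed

lemma ind_tensor_balanced:
  assumes h: "h \<in> carrier G" and k: "k \<in> K" and v: "v \<in> V"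
  shows "ind_tensor G (G\<lparr>carrier := K\<rparr>) \<rho> (h \<otimes>\<^bsub>G\<^esub> k) v = ind_tensor G (G\<lparr>carrier := K\<rparr>) \<rho> h (\<rho> k v)"
proof -
  have kc: "k \<in> carrier G" using k K.mem_carrier by blast
  have mult: "\<rho> (l \<otimes>\<^bsub>G\<^esub> k) v = \<rho> l (\<rho> k v)" if "l \<in> K" for l
    using \<rho> that k v by (auto simp: representation_def)
  have e: "inv\<^bsub>G\<^esub> (h \<otimes>\<^bsub>G\<^esub> k) \<otimes>\<^bsub>G\<^esub> g = inv\<^bsub>G\<^esub> k \<otimes>\<^bsub>G\<^esub> (inv\<^bsub>G\<^esub> h \<otimes>\<^bsub>G\<^esub> g)" if "g \<in> carrier G" for g
    using h kc that by (simp add: inv_mult_group m_assoc)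
  have e2: "inv\<^bsub>G\<^esub> (inv\<^bsub>G\<^esub> k \<otimes>\<^bsub>G\<^esub> (inv\<^bsub>G\<^esub> h \<otimes>\<^bsub>G\<^esub> g)) = inv\<^bsub>G\<^esub> (inv\<^bsub>G\<^esub> h \<otimes>\<^bsub>G\<^esub> g) \<otimes>\<^bsub>G\<^esub> k" if "g \<in> carrier G" for g
    using h kc that by (simp add: inv_mult_group)
  have mem: "inv\<^bsub>G\<^esub> k \<otimes>\<^bsub>G\<^esub> (inv\<^bsub>G\<^esub> h \<otimes>\<^bsub>G\<^esub> g) \<in> K \<longleftrightarrow> inv\<^bsub>G\<^esub> h \<otimes>\<^bsub>G\<^esub> g \<in> K" if "g \<in> carrier G" for g
  proof -
    have "inv\<^bsub>G\<^esub> h \<otimes>\<^bsub>G\<^esub> g = k \<otimes>\<^bsub>G\<^esub> (inv\<^bsub>G\<^esub> k \<otimes>\<^bsub>G\<^esub> (inv\<^bsub>G\<^esub> h \<otimes>\<^bsub>G\<^esub> g))" using h kc that by (simp add: m_assoc[symmetric])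
    then show ?thesis using k by (metis K.m_closed K.m_inv_closed)
  qed
  show ?thesis unfolding ind_tensor_def
    by (auto simp: fun_eq_iff e mem) (metis e2 mult K.m_inv_closed)+
qed

lemma ind_act_ind_tensor:
  assumes x: "x \<in> carrier G" and h: "h \<in> carrier G"
  shows "ind_act G x (ind_tensor G (G\<lparr>carrier := K\<rparr>) \<rho> h v) =
    ind_tensor G (G\<lparr>carrier := K\<rparr>) \<rho> (x \<otimes>\<^bsub>G\<^esub> h) v"
  using x h by (auto simp: ind_act_def ind_tensor_def fun_eq_iff inv_mult_group m_assoc)

end


section \<open>The representations $\theta_{\chi,\mu}$ of $G^\tau$\<close>

definition char_stabilizer ::
    "nat \<Rightarrow> (nat \<Rightarrow> bit) set \<Rightarrow> (nat \<Rightarrow> nat) \<Rightarrow> ((nat \<Rightarrow> bit) \<Rightarrow> complex) \<Rightarrow> (nat \<Rightarrow> nat) monoid" where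
  "char_stabilizer n A \<tau> \<chi> = (sym_group n)\<lparr>carrier :=
    {h \<in> carrier (centralizer (sym_group n) \<tau>).
      \<forall>a \<in> fixed_vectors A \<tau>. \<chi> (perm_act (inv' h) a) = \<chi> a}\<rparr>"

definition char_tensor ::
    "('a \<Rightarrow> complex) \<Rightarrow> ('h \<Rightarrow> ('i \<Rightarrow> complex) \<Rightarrow> ('i \<Rightarrow> complex)) \<Rightarrow>
      'a \<times> 'h \<Rightarrow> ('i \<Rightarrow> complex) \<Rightarrow> ('i \<Rightarrow> complex)" where
  "char_tensor \<chi> \<mu> = (\<lambda>(a, h) v. cscale (\<chi> a) (\<mu> h v))"

text \<open>The underlying space of $\theta_{\chi,\mu}$; the action is \<^const>\<open>ind_act\<close>.\<close>

definition theta_space ::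
    "nat \<Rightarrow> (nat \<Rightarrow> bit) set \<Rightarrow> (nat \<Rightarrow> nat) \<Rightarrow> ((nat \<Rightarrow> bit) \<Rightarrow> complex) \<Rightarrow>
      ('i \<Rightarrow> complex) set \<Rightarrow> ((nat \<Rightarrow> nat) \<Rightarrow> ('i \<Rightarrow> complex) \<Rightarrow> ('i \<Rightarrow> complex)) \<Rightarrow>
      (((nat \<Rightarrow> bit) \<times> (nat \<Rightarrow> nat)) \<times> 'i \<Rightarrow> complex) set" where
  "theta_space n A \<tau> \<chi> V \<mu> =
    ind_space (centralizer (semidirect A (carrier (sym_group n))) (0, \<tau>))
      (semidirect (fixed_vectors A \<tau>) (carrier (char_stabilizer n A \<tau> \<chi>)))
      V (char_tensor \<chi> \<mu>)"


section \<open>Braidings of Yetter-Drinfeld modules\<close>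

text \<open>A coaction of $\mathbb C G$ on $M$ is given by its components: $\delta(x) = \sum_g g \otimes x_g$
  with \<open>x\<^sub>g = coact g x\<close>.  The braiding $x \otimes y \mapsto \sum_g g \cdot y \otimes x_g$ applies
  \<open>coact g\<close> to the left factor, flips, and lets $g$ act on the left factor.\<close>

definition tensor2 :: "('x \<Rightarrow> complex) \<Rightarrow> ('y \<Rightarrow> complex) \<Rightarrow> ('x \<times> 'y \<Rightarrow> complex)" where
  "tensor2 x y = (\<lambda>(i, j). x i * y j)"

definition on_left ::
    "(('x \<Rightarrow> complex) \<Rightarrow> ('z \<Rightarrow> complex)) \<Rightarrow> ('x \<times> 'y \<Rightarrow> complex) \<Rightarrow> ('z \<times> 'y \<Rightarrow> complex)" where
  "on_left F t = (\<lambda>(i, j). F (\<lambda>k. t (k, j)) i)"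

definition flip :: "('x \<times> 'y \<Rightarrow> complex) \<Rightarrow> ('y \<times> 'x \<Rightarrow> complex)" where
  "flip t = (\<lambda>(j, i). t (i, j))"

definition yd_braiding ::
    "'g monoid \<Rightarrow> ('g \<Rightarrow> ('x \<Rightarrow> complex) \<Rightarrow> ('x \<Rightarrow> complex)) \<Rightarrow>
      ('g \<Rightarrow> ('x \<Rightarrow> complex) \<Rightarrow> ('x \<Rightarrow> complex)) \<Rightarrow>
      ('x \<times> 'x \<Rightarrow> complex) \<Rightarrow> ('x \<times> 'x \<Rightarrow> complex)" where
  "yd_braiding G act coact t =
    (\<Sum>g\<in>carrier G. on_left (act g) (flip (on_left (coact g) t)))"

lemma yd_braiding_tensor2:
  assumes "\<And>g c x. act g (cscale c x) = cscale c (act g x)"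
    and "\<And>g c x. coact g (cscale c x) = cscale c (coact g x)"
  shows "yd_braiding G act coact (tensor2 x y) = (\<Sum>g\<in>carrier G. tensor2 (act g y) (coact g x))"
proof -
  have "on_left (coact g) (tensor2 x y) = tensor2 (coact g x) y" for g
  proof -
    have "(\<lambda>k. x k * y j) = cscale (y j) x" for j by (auto simp: cscale_def)
    then show ?thesis by (auto simp: on_left_def tensor2_def assms(2)) (auto simp: cscale_def)
  qed
  moreover have "flip (tensor2 (coact g x) y) = tensor2 y (coact g x)" for g
    by (auto simp: flip_def tensor2_def)
  moreover have "on_left (act g) (tensor2 y (coact g x)) = tensor2 (act g y) (coact g x)" for g
  proof -
    have "(\<lambda>k. y k * coact g x j) = cscale (coact g x j) y" for j by (auto simp: cscale_def)
    then show ?thesis by (auto simp: on_left_def tensor2_def assms(1)) (auto simp: cscale_def)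
  qed
  ultimately show ?thesis by (simp add: yd_braiding_def)
qed

text \<open>The Yetter-Drinfeld module $M(\mathcal O_s^G,\rho) = \mathbb C G \otimes_{\mathbb C G^s} V$:
  its space, the components of its coaction
  $\delta(h \otimes v) = hsh^{-1} \otimes (h \otimes v)$, and its braiding; the action is
  \<^const>\<open>ind_act\<close>.\<close>

definition class_module ::
    "'g monoid \<Rightarrow> 'g \<Rightarrow> ('i \<Rightarrow> complex) set \<Rightarrow>
      ('g \<Rightarrow> ('i \<Rightarrow> complex) \<Rightarrow> ('i \<Rightarrow> complex)) \<Rightarrow> ('g \<times> 'i \<Rightarrow> complex) set" where
  "class_module G s V \<rho> = ind_space G (centralizer G s) V \<rho>"

definition class_coaction ::
    "'g monoid \<Rightarrow> 'g \<Rightarrow> 'g \<Rightarrow> ('g \<times> 'i \<Rightarrow> complex) \<Rightarrow> ('g \<times> 'i \<Rightarrow> complex)" where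
  "class_coaction G s g f = (\<lambda>(h, i). if conj_by G h s = g then f (h, i) else 0)"

definition class_braiding ::
    "'g monoid \<Rightarrow> 'g \<Rightarrow>
      (('g \<times> 'i) \<times> ('g \<times> 'i) \<Rightarrow> complex) \<Rightarrow> (('g \<times> 'i) \<times> ('g \<times> 'i) \<Rightarrow> complex)" where
  "class_braiding G s = yd_braiding G (ind_act G) (class_coaction G s)"

lemma class_coaction_ind_tensor:
  assumes G: "group G" and s: "s \<in> carrier G" and h: "h \<in> carrier G"
  shows "class_coaction G s g (ind_tensor G (centralizer G s) \<rho> h v) =
    (if g = conj_by G h s then ind_tensor G (centralizer G s) \<rho> h v else 0)"
proof -
  interpret group G by (fact G)
  have "conj_by G k s = conj_by G h s" if k: "k \<in> carrier G" and c: "inv\<^bsub>G\<^esub> h \<otimes>\<^bsub>G\<^esub> k \<in> carrier (centralizer G s)" for k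
  proof -
    define l where "l = inv\<^bsub>G\<^esub> h \<otimes>\<^bsub>G\<^esub> k"
    have l: "l \<in> carrier G" "l \<otimes>\<^bsub>G\<^esub> s = s \<otimes>\<^bsub>G\<^esub> l" using c by (auto simp: centralizer_def l_def)
    have kl: "k = h \<otimes>\<^bsub>G\<^esub> l" using h k by (simp add: l_def m_assoc[symmetric])
    have "k \<otimes>\<^bsub>G\<^esub> s \<otimes>\<^bsub>G\<^esub> inv\<^bsub>G\<^esub> k = h \<otimes>\<^bsub>G\<^esub> (l \<otimes>\<^bsub>G\<^esub> s) \<otimes>\<^bsub>G\<^esub> inv\<^bsub>G\<^esub> l \<otimes>\<^bsub>G\<^esub> inv\<^bsub>G\<^esub> h"
      using h l(1) s by (simp add: kl inv_mult_group m_assoc)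
    also have "\<dots> = h \<otimes>\<^bsub>G\<^esub> s \<otimes>\<^bsub>G\<^esub> (l \<otimes>\<^bsub>G\<^esub> inv\<^bsub>G\<^esub> l) \<otimes>\<^bsub>G\<^esub> inv\<^bsub>G\<^esub> h"
      unfolding l(2) using h l(1) s by (simp only: m_assoc m_closed inv_closed)
    also have "\<dots> = h \<otimes>\<^bsub>G\<^esub> s \<otimes>\<^bsub>G\<^esub> inv\<^bsub>G\<^esub> h" using h l(1) s by simp
    finally show ?thesis by (simp add: conj_by_def)
  qed
  then show ?thesis by (auto simp: class_coaction_def ind_tensor_def fun_eq_iff)
qed

lemma class_braiding_tensor2:
  "class_braiding G s (tensor2 x y) =
    (\<Sum>g\<in>carrier G. tensor2 (ind_act G g y) (class_coaction G s g x))"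
  unfolding class_braiding_def
  by (rule yd_braiding_tensor2) (auto simp: ind_act_def class_coaction_def cscale_def fun_eq_iff)


section \<open>Nichols algebras\<close>

text \<open>For $M \subseteq \mathbb C^X$, the tensor power $M^{\otimes k}$ is the span of the functions
  $(i_1,\dots,i_k) \mapsto x_1(i_1)\cdots x_k(i_k)$ with $x_1,\dots,x_k \in M$, and $T(M)$ is a space
  of functions on lists, the words of length $k$ carrying degree $k$.\<close>

definition pure_tensor :: "('x \<Rightarrow> complex) list \<Rightarrow> ('x list \<Rightarrow> complex)" where
  "pure_tensor xs = (\<lambda>w. if length w = length xs then \<Prod>k<length xs. (xs ! k) (w ! k) else 0)"

definition tensor_algebra :: "('x \<Rightarrow> complex) set \<Rightarrow> (complex, 'x list \<Rightarrow> complex) module" where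
  "tensor_algebra M =
    \<lparr>carrier = cfun.span {pure_tensor xs | xs. set xs \<subseteq> M},
     monoid.mult = (\<lambda>f g w. \<Sum>k\<le>length w. f (take k w) * g (drop k w)),
     one = pure_tensor [],
     ring.zero = 0,
     ring.add = (+),
     smult = cscale\<rparr>"

text \<open>\<open>braid_at c k\<close> applies the braiding \<open>c\<close> to the tensor factors $k$ and $k+1$, counted from $0$.\<close>

definition braid_at ::
    "(('x \<times> 'x \<Rightarrow> complex) \<Rightarrow> ('x \<times> 'x \<Rightarrow> complex)) \<Rightarrow> nat \<Rightarrow>
      ('x list \<Rightarrow> complex) \<Rightarrow> ('x list \<Rightarrow> complex)" where
  "braid_at c k t = (\<lambda>w. if Suc k < length w
     then c (\<lambda>(a, b). t (w[k := a, Suc k := b])) (w ! k, w ! Suc k) else 0)"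

definition on_tail ::
    "(('x list \<Rightarrow> complex) \<Rightarrow> ('x list \<Rightarrow> complex)) \<Rightarrow> ('x list \<Rightarrow> complex) \<Rightarrow> ('x list \<Rightarrow> complex)" where
  "on_tail F t = (\<lambda>w. case w of [] \<Rightarrow> 0 | a # u \<Rightarrow> F (\<lambda>u'. t (a # u')) u)"

text \<open>The quantum symmetrizer $\mathfrak S_k = \sum_{w \in \mathbb S_k} c_w$ on $M^{\otimes k}$, where
  $c_w = c_{i_1} \cdots c_{i_l}$ for a reduced expression of $w$.  Every $w \in \mathbb S_{k+1}$ is
  uniquely a length-additive product of an element of $\mathbb S_k$ acting on the last $k$ letters
  and one of $1, s_0, s_0s_1, \dots, s_0s_1\cdots s_{k-1}$, so that
  $\mathfrak S_{k+1} = (\mathrm{id} \otimes \mathfrak S_k)(1 + c_0 + c_0c_1 + \dots + c_0c_1\cdots c_{k-1})$.\<close>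

primrec quantum_symmetrizer ::
    "(('x \<times> 'x \<Rightarrow> complex) \<Rightarrow> ('x \<times> 'x \<Rightarrow> complex)) \<Rightarrow> nat \<Rightarrow>
      ('x list \<Rightarrow> complex) \<Rightarrow> ('x list \<Rightarrow> complex)" where
  "quantum_symmetrizer c 0 = id"
| "quantum_symmetrizer c (Suc k) =
    (\<lambda>t. on_tail (quantum_symmetrizer c k) (\<Sum>j\<le>k. foldr (braid_at c) [0..<j] t))"

definition homogeneous_part :: "nat \<Rightarrow> ('x list \<Rightarrow> complex) \<Rightarrow> ('x list \<Rightarrow> complex)" where
  "homogeneous_part k t = (\<lambda>w. if length w = k then t w else 0)"

text \<open>The Nichols algebra is $T(M) / \bigoplus_k \ker \mathfrak S_k$.\<close>

definition nichols_ideal ::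
    "('x \<Rightarrow> complex) set \<Rightarrow> (('x \<times> 'x \<Rightarrow> complex) \<Rightarrow> ('x \<times> 'x \<Rightarrow> complex)) \<Rightarrow> ('x list \<Rightarrow> complex) set" where
  "nichols_ideal M c =
    {t \<in> carrier (tensor_algebra M). \<forall>k. quantum_symmetrizer c k (homogeneous_part k t) = 0}"

definition quotient_algebra :: "('c, 'a) module \<Rightarrow> 'a set \<Rightarrow> ('c, 'a set) module" where
  "quotient_algebra T J =
    \<lparr>carrier = a_rcosets\<^bsub>T\<^esub> J, monoid.mult = rcoset_mult T J,
     one = J +>\<^bsub>T\<^esub> \<one>\<^bsub>T\<^esub>, ring.zero = J, ring.add = set_add T,
     smult = (\<lambda>c K. \<Union>x\<in>K. J +>\<^bsub>T\<^esub> (c \<odot>\<^bsub>T\<^esub> x))\<rparr>"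

definition nichols_algebra ::
    "('x \<Rightarrow> complex) set \<Rightarrow> (('x \<times> 'x \<Rightarrow> complex) \<Rightarrow> ('x \<times> 'x \<Rightarrow> complex)) \<Rightarrow>
      (complex, ('x list \<Rightarrow> complex) set) module" where
  "nichols_algebra M c = quotient_algebra (tensor_algebra M) (nichols_ideal M c)"

definition finite_dimensional :: "('c, 'a) module \<Rightarrow> bool" where
  "finite_dimensional B \<longleftrightarrow>
    (\<exists>S. finite S \<and> S \<subseteq> carrier B \<and>
      (\<forall>x\<in>carrier B. \<exists>c. x = (\<Oplus>\<^bsub>B\<^esub>b\<in>S. c b \<odot>\<^bsub>B\<^esub> b)))"

definition class_nichols_algebra ::
    "'g monoid \<Rightarrow> 'g \<Rightarrow> ('i \<Rightarrow> complex) set \<Rightarrow>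
      ('g \<Rightarrow> ('i \<Rightarrow> complex) \<Rightarrow> ('i \<Rightarrow> complex)) \<Rightarrow>
      (complex, (('g \<times> 'i) list \<Rightarrow> complex) set) module" where
  "class_nichols_algebra G s V \<rho> = nichols_algebra (class_module G s V \<rho>) (class_braiding G s)"

end

theory Submission
  imports Defs
begin

text \<open>
  The first assertions hold because $z = (\alpha, 1)$ is a central involution of $G$ and
  $(\alpha,\tau) = z \cdot (0,\tau)$: multiplying by a central element changes neither centralizers
  nor the conjugation action, so it carries conjugacy classes to conjugacy classes and is an
  isomorphism of racks.

  For the Nichols algebras, the two Yetter-Drinfeld modules over $(\alpha,\tau)$ and $(0,\tau)$ are
  the same space $M$, and $z$ acts on $\theta_{\chi,\mu}$ by the scalar $\chi(\alpha)$
  (\<open>all_ones_acts_by_character\<close>).  Since the coaction is multiplied by $z$, the braiding of $M$ over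
  $(\alpha,\tau)$ is $\chi(\alpha)$ times the braiding over $(0,\tau)$.

  If $\chi(\alpha) = 1$, the two braidings agree on the tensors that occur, so the two Nichols algebras
  are equal (\<open>class_nichols_algebra_central_twist\<close>).

  If $\chi(\alpha) = -1$, let $v$ be an eigenvector of $\tau$ in the representation, with eigenvalue
  $q$; then $(\alpha,\tau)$ acts on $v$ by $-q$.  A permutation is conjugate to its inverse, hence so are
  both $(0,\tau)$ and $(\alpha,\tau)$.  For an element $s$ conjugate to $s^{-1}$, finite dimension
  forces the eigenvalue of $s$ to be $-1$
  (\<open>eigenvalue_minus_one_of_finite_dimensional\<close>), and $q = -q = -1$ is absurd.

  The statement about the eigenvalue is proved by exhibiting nonzero elements of arbitrarily high
  degree.  If $s = h^{-1}s^{-1}h$, the vectors $x = 1 \otimes v$ and $y = h \otimes v$ satisfy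
  $c(x \otimes x) = q\, x \otimes x$, $c(y \otimes y) = q\, y \otimes y$,
  $c(x \otimes y) = q^{-1} y \otimes x$, $c(y \otimes x) = q^{-1} x \otimes y$.
  If $q = 1$, the powers $x^m$ survive, the quantum symmetrizer being multiplication by $m!$ on them.
  If $q^2 \neq 1$, this is a braiding of affine Cartan type $A_1^{(1)}$, and the powers of its
  imaginary root vector $xy - q^{-1}yx$ survive.  Both facts are computed with the skew
  derivations of the tensor algebra: on functions on words, the quantum symmetrizer evaluated at a
  word is an iterated skew derivation, one for each letter (\<open>quantum_symmetrizer_value\<close>).
\<close>

section \<open>Central elements\<close>

lemma center_carrier: "a \<in> center H \<Longrightarrow> a \<in> carrier H"
  and center_commute: "a \<in> center H \<Longrightarrow> g \<in> carrier H \<Longrightarrow> a \<otimes>\<^bsub>H\<^esub> g = g \<otimes>\<^bsub>H\<^esub> a"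
  by (auto simp: center_def)

context
  fixes G :: "'g monoid" (structure)
  assumes G: "group G"
begin

interpretation group G by (fact G)

lemma conj_by_central_mult:
  assumes a: "a \<in> center G" and g: "g \<in> carrier G" and s: "s \<in> carrier G"
  shows "conj_by G g (a \<otimes> s) = a \<otimes> conj_by G g s"
proof -
  note ac = center_carrier[OF a]
  have "conj_by G g (a \<otimes> s) = (g \<otimes> a) \<otimes> s \<otimes> inv g"
    using ac g s by (simp add: conj_by_def m_assoc)
  also have "\<dots> = a \<otimes> conj_by G g s"
    unfolding center_commute[OF a g, symmetric] using ac g s by (simp add: conj_by_def m_assoc)
  finally show ?thesis .
qed

lemma conj_by_central_left:
  assumes a: "a \<in> center G" and g: "g \<in> carrier G" and s: "s \<in> carrier G"
  shows "conj_by G (a \<otimes> g) s = conj_by G g s"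
proof -
  note ac = center_carrier[OF a]
  have "conj_by G (a \<otimes> g) s = (a \<otimes> (g \<otimes> s \<otimes> inv g)) \<otimes> inv a"
    using ac g s by (simp add: conj_by_def m_assoc inv_mult_group)
  also have "\<dots> = conj_by G g s"
    unfolding center_commute[OF a m_closed[OF m_closed[OF g s] inv_closed[OF g]]]
    using ac g s by (simp add: conj_by_def m_assoc)
  finally show ?thesis .
qed

lemma conj_class_central_mult:
  assumes a: "a \<in> center G" and s: "s \<in> carrier G"
  shows "conj_class G (a \<otimes> s) = a <# conj_class G s"
  using conj_by_central_mult[OF a _ s] by (auto simp: conj_class_def l_coset_def)

lemma inv_center:
  assumes c: "c \<in> center G"
  shows "inv c \<in> center G"
proof -
  note cc = center_carrier[OF c]
  have "inv c \<otimes> g = g \<otimes> inv c" if g: "g \<in> carrier G" for g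
  proof -
    have "inv c \<otimes> g = inv c \<otimes> (g \<otimes> c) \<otimes> inv c" using cc g by (simp add: m_assoc)
    also have "\<dots> = g \<otimes> inv c"
      unfolding center_commute[OF c g, symmetric] using cc g by (simp add: m_assoc[symmetric])
    finally show ?thesis .
  qed
  then show ?thesis using cc by (simp add: center_def)
qed

lemma centralizer_central_mult:
  assumes z: "z \<in> center G" and s: "s \<in> carrier G"
  shows "centralizer G (z \<otimes> s) = centralizer G s"
proof -
  note zc = center_carrier[OF z]
  have "g \<otimes> (z \<otimes> s) = z \<otimes> s \<otimes> g \<longleftrightarrow> g \<otimes> s = s \<otimes> g" if g: "g \<in> carrier G" for g
  proof -
    have "g \<otimes> (z \<otimes> s) = z \<otimes> (g \<otimes> s)"
      using center_commute[OF z g] g s zc by (simp add: m_assoc[symmetric])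
    then show ?thesis using g s zc by (simp add: m_assoc)
  qed
  then have "{g \<in> carrier G. g \<otimes> (z \<otimes> s) = z \<otimes> s \<otimes> g} = {g \<in> carrier G. g \<otimes> s = s \<otimes> g}"
    by blast
  then show ?thesis unfolding centralizer_def by (simp only:)
qed

lemma centralizer_subgroup:
  assumes s: "s \<in> carrier G"
  shows "subgroup {g \<in> carrier G. g \<otimes> s = s \<otimes> g} G" (is "subgroup ?K G")
proof (rule subgroupI)
  fix a assume "a \<in> ?K"
  then have a: "a \<in> carrier G" "a \<otimes>\<^bsub>G\<^esub> s = s \<otimes>\<^bsub>G\<^esub> a" by auto
  have "inv\<^bsub>G\<^esub> a \<otimes>\<^bsub>G\<^esub> (a \<otimes>\<^bsub>G\<^esub> s) \<otimes>\<^bsub>G\<^esub> inv\<^bsub>G\<^esub> a = s \<otimes>\<^bsub>G\<^esub> inv\<^bsub>G\<^esub> a"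
    using a(1) s by (simp add: m_assoc[symmetric])
  moreover have "inv\<^bsub>G\<^esub> a \<otimes>\<^bsub>G\<^esub> (s \<otimes>\<^bsub>G\<^esub> a) \<otimes>\<^bsub>G\<^esub> inv\<^bsub>G\<^esub> a = inv\<^bsub>G\<^esub> a \<otimes>\<^bsub>G\<^esub> s"
    using a(1) s by (simp add: m_assoc)
  ultimately show "inv\<^bsub>G\<^esub> a \<in> ?K" using a by simp
next
  fix a b assume "a \<in> ?K" "b \<in> ?K"
  then have ab: "a \<in> carrier G" "a \<otimes>\<^bsub>G\<^esub> s = s \<otimes>\<^bsub>G\<^esub> a" "b \<in> carrier G" "b \<otimes>\<^bsub>G\<^esub> s = s \<otimes>\<^bsub>G\<^esub> b" by auto
  have "a \<otimes>\<^bsub>G\<^esub> b \<otimes>\<^bsub>G\<^esub> s = a \<otimes>\<^bsub>G\<^esub> s \<otimes>\<^bsub>G\<^esub> b" using ab(1,3,4) s by (simp add: m_assoc)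
  also have "\<dots> = s \<otimes>\<^bsub>G\<^esub> (a \<otimes>\<^bsub>G\<^esub> b)" unfolding ab(2) using ab(1,3) s by (simp add: m_assoc)
  finally show "a \<otimes>\<^bsub>G\<^esub> b \<in> ?K" using ab s by (simp add: m_assoc)
qed (use s in auto)

end

section \<open>Racks of type D\<close>

lemma rack_image_under_morphism:
  assumes f: "inj_on f R" and hom: "\<And>x y. x \<in> R \<Longrightarrow> y \<in> R \<Longrightarrow> opr (f x) (f y) = f (opr x y)"
    and R: "rack R opr"
  shows "rack (f ` R) opr"
proof -
  have closed: "opr x y \<in> R" if "x \<in> R" "y \<in> R" for x y
    using R that bij_betwE unfolding rack_def by blast
  have "bij_betw (opr (f x)) (f ` R) (f ` R)" if x: "x \<in> R" for x
  proof -
    have b: "bij_betw (opr x) R R" using R x by (simp add: rack_def)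
    have "inj_on (opr (f x)) (f ` R)"
    proof (rule inj_onI)
      fix u w assume "u \<in> f ` R" "w \<in> f ` R" and e: "opr (f x) u = opr (f x) w"
      then obtain y z where y: "y \<in> R" "u = f y" and z: "z \<in> R" "w = f z" by blast
      have "f (opr x y) = f (opr x z)" using e x y z by (simp add: hom)
      then have "opr x y = opr x z" by (rule inj_onD[OF f _ closed[OF x y(1)] closed[OF x z(1)]])
      then have "y = z" using bij_betw_imp_inj_on[OF b] y(1) z(1) by (blast dest: inj_onD)
      then show "u = w" using y z by simp
    qed
    moreover have "opr (f x) ` f ` R = f ` opr x ` R"
      using hom[OF x] by (auto simp: image_image)
    ultimately show ?thesis using b by (simp add: bij_betw_def)
  qed
  moreover have "opr (f x) (opr (f y) (f z)) = opr (opr (f x) (f y)) (opr (f x) (f z))"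
    if "x \<in> R" "y \<in> R" "z \<in> R" for x y z
  proof -
    have "opr x (opr y z) = opr (opr x y) (opr x z)" using R that by (simp only: rack_def)
    then show ?thesis using that by (simp only: hom closed)
  qed
  ultimately show ?thesis unfolding rack_def by blast
qed

text \<open>An injective rack morphism carries the decomposable subrack and the pair $(r,s)$
  witnessing type D to witnesses in the image.\<close>

lemma rack_type_D_image:
  assumes f: "inj_on f Q" and hom: "\<And>x y. x \<in> Q \<Longrightarrow> y \<in> Q \<Longrightarrow> opr (f x) (f y) = f (opr x y)"
    and D: "rack_type_D Q opr"
  shows "rack_type_D (f ` Q) opr"
proof -
  obtain R S r s where RS: "R \<union> S \<subseteq> Q" "R \<noteq> {}" "S \<noteq> {}" "R \<inter> S = {}"
    and racks: "rack (R \<union> S) opr" "rack R opr" "rack S opr"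
    and img: "rack_image opr R S = S" "rack_image opr S R = R"
    and rs: "r \<in> R" "s \<in> S" "opr r (opr s (opr r s)) \<noteq> s"
    and Q: "rack Q opr"
    using D unfolding rack_type_D_def by blast
  have closed: "opr x y \<in> Q" if "x \<in> Q" "y \<in> Q" for x y
    using Q that bij_betwE unfolding rack_def by blast
  have sub: "rack (f ` T) opr" if "rack T opr" "T \<subseteq> Q" for T
    using that by (intro rack_image_under_morphism inj_on_subset[OF f] hom) auto
  have image: "rack_image opr (f ` T) (f ` U) = f ` rack_image opr T U" if "T \<subseteq> Q" "U \<subseteq> Q" for T U
    using that hom by (force simp: rack_image_def image_UN image_image subset_iff)
  have sub_union: "rack (f ` R \<union> f ` S) opr"
    using sub[OF racks(1) RS(1)] by (simp add: image_Un)
  have disj: "f ` R \<inter> f ` S = {}" 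
    using inj_on_image_Int[OF f, of R S] RS(1,4) by simp
  have in_Q: "r \<in> Q" "s \<in> Q" using rs RS(1) by auto
  have "opr (f r) (opr (f s) (opr (f r) (f s))) \<noteq> f s"
    using rs(3) in_Q f by (simp add: hom closed inj_on_eq_iff)
  moreover have "f ` R \<union> f ` S \<subseteq> f ` Q" using RS(1) by auto
  moreover have "f ` R \<noteq> {}" "f ` S \<noteq> {}" using RS by auto
  moreover have "rack_image opr (f ` R) (f ` S) = f ` S" "rack_image opr (f ` S) (f ` R) = f ` R"
    using image img RS(1) by auto
  moreover have "rack (f ` R) opr" "rack (f ` S) opr" "rack (f ` Q) opr"
    using sub racks Q RS(1) by auto
  ultimately show ?thesis
    unfolding rack_type_D_def using sub_union disj rs(1,2) by blast
qed

context
  fixes G :: "'g monoid" (structure)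
  assumes G: "group G"
begin

interpretation group G by (fact G)

text \<open>Multiplication by a central element commutes with conjugation in both arguments:
  $(ax) \rhd (ay) = a (x \rhd y)$.\<close>

lemma rack_type_D_central_translate:
  assumes a: "a \<in> center G" and Q: "Q \<subseteq> carrier G" and D: "rack_type_D Q (conj_by G)"
  shows "rack_type_D (a <# Q) (conj_by G)"
proof -
  note ac = center_carrier[OF a]
  have "rack_type_D ((\<otimes>) a ` Q) (conj_by G)"
  proof (rule rack_type_D_image[OF _ _ D])
    show "inj_on ((\<otimes>) a) Q" using ac Q by (auto simp: inj_on_def subset_iff)
    show "conj_by G (a \<otimes> x) (a \<otimes> y) = a \<otimes> conj_by G x y" if "x \<in> Q" "y \<in> Q" for x y
      using that Q ac conj_by_central_left[OF G a, of x] conj_by_central_mult[OF G a, of x y]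
      by (auto simp: subset_iff)
  qed
  moreover have "(\<otimes>) a ` Q = a <# Q" by (auto simp: l_coset_def)
  ultimately show ?thesis by simp
qed

text \<open>The converse is the forward direction for $a^{-1}$, which is central too.\<close>

lemma rack_type_D_central_translate_iff:
  assumes a: "a \<in> center G" and Q: "Q \<subseteq> carrier G"
  shows "rack_type_D Q (conj_by G) \<longleftrightarrow> rack_type_D (a <# Q) (conj_by G)"
proof
  assume "rack_type_D (a <# Q) (conj_by G)"
  moreover have "a <# Q \<subseteq> carrier G" using center_carrier[OF a] Q by (auto simp: l_coset_def)
  ultimately have "rack_type_D (inv a <# (a <# Q)) (conj_by G)"
    by (rule rack_type_D_central_translate[OF inv_center[OF G a], rotated])
  moreover have "inv a <# (a <# Q) = Q"
    using center_carrier[OF a] Q by (simp add: lcos_m_assoc lcos_mult_one)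
  ultimately show "rack_type_D Q (conj_by G)" by simp
qed (rule rack_type_D_central_translate[OF a Q])

end

section \<open>Finite-dimensional Nichols algebras\<close>

text \<open>The operators on tensors are given by formulas that make sense for every function on words,
  so their linearity needs no restriction to a subspace, unlike that of \<^const>\<open>linear_map_on\<close>.\<close>

definition linear_operator :: "(('i \<Rightarrow> complex) \<Rightarrow> ('j \<Rightarrow> complex)) \<Rightarrow> bool" where
  "linear_operator F \<longleftrightarrow>
    (\<forall>s t. F (s + t) = F s + F t) \<and> (\<forall>a t. F (cscale a t) = cscale a (F t))"

lemma linear_operator_add: "linear_operator F \<Longrightarrow> F (s + t) = F s + F t"
  and linear_operator_scale: "linear_operator F \<Longrightarrow> F (cscale a t) = cscale a (F t)"
  by (auto simp: linear_operator_def)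

lemma linear_operator_zero: "linear_operator F \<Longrightarrow> F 0 = 0"
  using linear_operator_scale[of F 0 0] by (simp add: cscale_def zero_fun_def)

lemma linear_operator_comp:
  "linear_operator F \<Longrightarrow> linear_operator E \<Longrightarrow> linear_operator (\<lambda>t. F (E t))"
  by (simp add: linear_operator_def)

lemma linear_operator_sum:
  assumes "\<And>j. j \<in> S \<Longrightarrow> linear_operator (F j)"
  shows "linear_operator (\<lambda>t. \<Sum>j\<in>S. F j t)"
  using assms
  by (induction S rule: infinite_finite_induct)
    (auto simp: linear_operator_def cfun.scale_right_distrib algebra_simps)

lemma linear_operator_braid_at:
  assumes "linear_operator c"
  shows "linear_operator (braid_at c k)"
proof -
  have 1: "(\<lambda>(a, b). (s + t) (w[k := a, Suc k := b])) =
      (\<lambda>(a, b). s (w[k := a, Suc k := b])) + (\<lambda>(a, b). t (w[k := a, Suc k := b]))" for s t w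
    by (auto simp: fun_eq_iff)
  have 2: "(\<lambda>(a, b). cscale x t (w[k := a, Suc k := b])) =
      cscale x (\<lambda>(a, b). t (w[k := a, Suc k := b]))" for x t w
    by (auto simp: fun_eq_iff cscale_def)
  show ?thesis
    unfolding linear_operator_def braid_at_def 1 2
      linear_operator_add[OF assms] linear_operator_scale[OF assms]
    by (auto simp: fun_eq_iff cscale_def)
qed

lemma linear_operator_foldr:
  assumes "\<And>j. linear_operator (F j)"
  shows "linear_operator (foldr F js)"
  using assms
  by (induction js) (auto simp: linear_operator_def)

lemma linear_operator_on_tail:
  assumes "linear_operator F"
  shows "linear_operator (on_tail F)"
proof -
  have 1: "(\<lambda>u. (s + t) (a # u)) = (\<lambda>u. s (a # u)) + (\<lambda>u. t (a # u))" for s t and a :: 'a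
    by (auto simp: fun_eq_iff)
  have 2: "(\<lambda>u. cscale x t (a # u)) = cscale x (\<lambda>u. t (a # u))" for x t and a :: 'a
    by (auto simp: fun_eq_iff cscale_def)
  show ?thesis
    unfolding linear_operator_def on_tail_def 1 2
      linear_operator_add[OF assms] linear_operator_scale[OF assms]
    by (auto simp: fun_eq_iff cscale_def split: list.split)
qed

lemma linear_operator_quantum_symmetrizer:
  assumes "linear_operator c"
  shows "linear_operator (quantum_symmetrizer c k)"
proof (induction k)
  case 0
  show ?case by (simp add: linear_operator_def)
next
  case (Suc k)
  have "linear_operator (\<lambda>t. \<Sum>j\<le>k. foldr (braid_at c) [0..<j] t)"
    by (intro linear_operator_sum linear_operator_foldr linear_operator_braid_at assms)
  from linear_operator_comp[OF linear_operator_on_tail[OF Suc.IH] this]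
  show ?case by simp
qed

lemma linear_operator_homogeneous_part: "linear_operator (homogeneous_part k)"
  by (auto simp: linear_operator_def homogeneous_part_def fun_eq_iff cscale_def)

lemma tensor_algebra_subspace: "cfun.subspace (carrier (tensor_algebra M))"
  by (simp add: tensor_algebra_def cfun.subspace_span)

lemma tensor_algebra_abelian_group: "abelian_group (tensor_algebra M)"
proof (rule abelian_groupI)
  note sub = tensor_algebra_subspace[of M]
  fix x assume x: "x \<in> carrier (tensor_algebra M)"
  then have "cscale (- 1) x \<in> carrier (tensor_algebra M)"
    using sub cfun.subspace_scale by blast
  moreover have "cscale (- 1) x + x = 0" by (auto simp: cscale_def fun_eq_iff)
  ultimately show "\<exists>y\<in>carrier (tensor_algebra M).
      y \<oplus>\<^bsub>tensor_algebra M\<^esub> x = \<zero>\<^bsub>tensor_algebra M\<^esub>"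
    by (intro bexI[of _ "cscale (- 1) x"]) (auto simp: tensor_algebra_def)
qed (use tensor_algebra_subspace[of M] cfun.subspace_0 cfun.subspace_add
  in \<open>auto simp: tensor_algebra_def algebra_simps\<close>)

lemma nichols_ideal_subspace:
  assumes "linear_operator c"
  shows "cfun.subspace (nichols_ideal M c)"
proof -
  have lin: "linear_operator (\<lambda>t. quantum_symmetrizer c k (homogeneous_part k t))" for k
    by (rule linear_operator_comp[OF linear_operator_quantum_symmetrizer[OF assms]
      linear_operator_homogeneous_part])
  show ?thesis
    using tensor_algebra_subspace[of M] linear_operator_zero[OF lin]
      linear_operator_add[OF lin] linear_operator_scale[OF lin]
    by (auto simp: cfun.subspace_def nichols_ideal_def)
qed

lemma subspace_additive_subgroup:
  assumes "cfun.subspace J" and "J \<subseteq> carrier (tensor_algebra M)"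
  shows "subgroup J (add_monoid (tensor_algebra M))"
proof -
  interpret T: abelian_group "tensor_algebra M" by (rule tensor_algebra_abelian_group)
  show ?thesis
  proof (rule group.subgroupI[OF T.a_group])
    fix t assume t: "t \<in> J"
    have "cscale (- 1) t \<in> J" using t assms(1) cfun.subspace_scale by blast
    moreover have "cscale (- 1) t \<oplus>\<^bsub>tensor_algebra M\<^esub> t = \<zero>\<^bsub>tensor_algebra M\<^esub>"
      by (auto simp: cscale_def fun_eq_iff tensor_algebra_def)
    then have "\<ominus>\<^bsub>tensor_algebra M\<^esub> t = cscale (- 1) t"
      using t assms(2) \<open>cscale (- 1) t \<in> J\<close> by (intro T.minus_equality) auto
    ultimately show "inv\<^bsub>add_monoid (tensor_algebra M)\<^esub> t \<in> J" by (simp add: a_inv_def)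
  qed (use assms cfun.subspace_0 cfun.subspace_add in \<open>auto simp: tensor_algebra_def\<close>)
qed

lemma tensor_algebra_bounded_length:
  assumes "t \<in> carrier (tensor_algebra M)"
  shows "\<exists>K. \<forall>w. length w \<ge> K \<longrightarrow> t w = 0"
proof -
  have "t \<in> cfun.span {pure_tensor xs | xs. set xs \<subseteq> M}" using assms by (simp add: tensor_algebra_def)
  then show ?thesis
  proof (induction rule: cfun.span_induct_alt)
    case base
    show ?case by auto
  next
    case (step a x y)
    then obtain xs K where "x = pure_tensor xs" and K: "\<forall>w. length w \<ge> K \<longrightarrow> y w = 0" by auto
    then have "(cscale a x + y) w = 0" if "length w \<ge> max K (Suc (length xs))" for w
      using that by (auto simp: pure_tensor_def cscale_def)
    then show ?case by blast
  qed
qed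

lemma comm_monoid_eqI:
  assumes "comm_monoid A" and "carrier B = carrier A" and "monoid.mult B = monoid.mult A"
    and "one B = one A"
  shows "comm_monoid B"
  using assms(1) unfolding comm_monoid_def monoid_def comm_monoid_axioms_def assms(2-) .

text \<open>A finite spanning set has representatives in finitely many degrees.  A tensor of larger
  degree is congruent to a combination of these representatives modulo a graded ideal, and
  comparison of the components in that degree puts it into the ideal.\<close>

lemma finite_dimensional_nichols_bounded:
  assumes c: "linear_operator c" and fd: "finite_dimensional (nichols_algebra M c)"
  obtains K where "\<And>k t. k \<ge> K \<Longrightarrow> t \<in> carrier (tensor_algebra M) \<Longrightarrow>
    quantum_symmetrizer c k (homogeneous_part k t) = 0"
proof -
  define T where "T = tensor_algebra M"
  define J where "J = nichols_ideal M c"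
  define B where "B = nichols_algebra M c"
  interpret T: abelian_group T unfolding T_def by (rule tensor_algebra_abelian_group)
  have Tsub: "cfun.subspace (carrier T)" unfolding T_def by (rule tensor_algebra_subspace)
  have Jsub: "cfun.subspace J" unfolding J_def by (rule nichols_ideal_subspace[OF c])
  have JT: "J \<subseteq> carrier T" by (auto simp: J_def T_def nichols_ideal_def)
  have Jgrp: "subgroup J (add_monoid T)"
    using subspace_additive_subgroup Jsub JT unfolding T_def by blast
  interpret J: abelian_subgroup J T
    by (rule abelian_subgroupI3[OF _ T.abelian_group_axioms]) (simp add: additive_subgroup_def Jgrp)
  have addT: "x \<oplus>\<^bsub>T\<^esub> y = x + y" and scT: "a \<odot>\<^bsub>T\<^esub> x = cscale a x" for a x y
    by (auto simp: T_def tensor_algebra_def)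
  have "carrier B = carrier (A_FactGroup T J)" "ring.add B = monoid.mult (A_FactGroup T J)"
      "ring.zero B = one (A_FactGroup T J)"
    by (auto simp: B_def nichols_algebra_def quotient_algebra_def J_def T_def A_FactGroup_def
      FactGroup_def set_add_def A_RCOSETS_def)
  moreover have "comm_monoid (A_FactGroup T J)"
    using J.a_factorgroup_is_comm_group by (simp only: comm_group_def)
  ultimately have B_comm: "comm_monoid (add_monoid B)"
    by - (rule comm_monoid_eqI[of "A_FactGroup T J"], simp_all only: monoid_record_simps)
  then interpret B: abelian_monoid B by (rule abelian_monoid.intro)
  have cosetB: "J +>\<^bsub>T\<^esub> t \<in> carrier B" if "t \<in> carrier T" for t
    using T.a_rcosetsI[OF JT that]
    by (simp add: B_def nichols_algebra_def quotient_algebra_def J_def T_def)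
  have B_coset: "\<exists>t\<in>carrier T. b = J +>\<^bsub>T\<^esub> t" if "b \<in> carrier B" for b
    using that
    by (auto simp: B_def nichols_algebra_def quotient_algebra_def J_def T_def A_RCOSETS_def')
  have add: "(J +>\<^bsub>T\<^esub> s) \<oplus>\<^bsub>B\<^esub> (J +>\<^bsub>T\<^esub> t) = J +>\<^bsub>T\<^esub> (s + t)"
    if "s \<in> carrier T" "t \<in> carrier T" for s t
    using J.a_rcos_sum[OF that]
    by (simp add: B_def nichols_algebra_def quotient_algebra_def J_def T_def addT[unfolded T_def])
  have mem_coset: "x \<in> J +>\<^bsub>T\<^esub> t \<longleftrightarrow> (\<exists>j\<in>J. x = j + t)" for x t
    by (auto simp: a_r_coset_def' addT)
  have coset_eqI: "J +>\<^bsub>T\<^esub> x = J +>\<^bsub>T\<^esub> t" if "x \<in> J +>\<^bsub>T\<^esub> t" "t \<in> carrier T" for x t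
    using T.a_repr_independence[OF that Jgrp] by simp
  have scale: "a \<odot>\<^bsub>B\<^esub> (J +>\<^bsub>T\<^esub> t) = J +>\<^bsub>T\<^esub> (cscale a t)" if t: "t \<in> carrier T" for a t
  proof -
    have "J +>\<^bsub>T\<^esub> (cscale a x) = J +>\<^bsub>T\<^esub> (cscale a t)" if x: "x \<in> J +>\<^bsub>T\<^esub> t" for x
    proof (rule coset_eqI)
      obtain j where "j \<in> J" "x = j + t" using x by (auto simp: mem_coset)
      then show "cscale a x \<in> J +>\<^bsub>T\<^esub> (cscale a t)"
        using Jsub cfun.subspace_scale by (auto simp: mem_coset cfun.scale_right_distrib)
      show "cscale a t \<in> carrier T" using t Tsub cfun.subspace_scale by blast
    qed
    moreover have "t \<in> J +>\<^bsub>T\<^esub> t"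
      using cfun.subspace_0[OF Jsub] by (auto simp: mem_coset)
    ultimately have "(\<Union>x\<in>J +>\<^bsub>T\<^esub> t. J +>\<^bsub>T\<^esub> (cscale a x)) = J +>\<^bsub>T\<^esub> (cscale a t)" by blast
    then show ?thesis
      by (simp add: B_def nichols_algebra_def quotient_algebra_def J_def T_def scT[unfolded T_def])
  qed
  obtain S where S: "finite S" "S \<subseteq> carrier B"
    and span: "\<And>x. x \<in> carrier B \<Longrightarrow> \<exists>a. x = (\<Oplus>\<^bsub>B\<^esub>b\<in>S. a b \<odot>\<^bsub>B\<^esub> b)"
    using fd unfolding finite_dimensional_def B_def[symmetric] by blast
  \<comment> \<open>\<open>K\<close> bounds the degrees that occur in the representative \<open>t\<close> of the coset \<open>b\<close>\<close>
  define represents where "represents b t K \<longleftrightarrow> t \<in> carrier T \<and> b = J +>\<^bsub>T\<^esub> t \<and>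
    (\<forall>w. length w \<ge> K \<longrightarrow> t w = 0)" for b t K
  have "\<exists>t K. represents b t K" if b: "b \<in> S" for b
  proof -
    obtain t where "t \<in> carrier T" "b = J +>\<^bsub>T\<^esub> t" using B_coset b S(2) by blast
    with tensor_algebra_bounded_length[of t M] show ?thesis
      unfolding T_def represents_def by blast
  qed
  then obtain rep bd where "\<And>b. b \<in> S \<Longrightarrow> represents b (rep b) (bd b)" by metis
  then have rep: "\<And>b. b \<in> S \<Longrightarrow> rep b \<in> carrier T" "\<And>b. b \<in> S \<Longrightarrow> b = J +>\<^bsub>T\<^esub> rep b"
    and bd: "\<And>b w. b \<in> S \<Longrightarrow> length w \<ge> bd b \<Longrightarrow> rep b w = 0"
    unfolding represents_def by blast+
  define K where "K = Suc (Max (insert 0 (bd ` S)))"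
  have bdK: "rep b w = 0" if "b \<in> S" "length w \<ge> K" for b w
  proof (rule bd[OF that(1)])
    have "bd b \<le> Max (insert 0 (bd ` S))" using that S(1) by (intro Max_ge) auto
    then show "length w \<ge> bd b" using that(2) by (simp add: K_def)
  qed
  have comb: "\<exists>t\<in>carrier T. (\<Oplus>\<^bsub>B\<^esub>b\<in>F. a b \<odot>\<^bsub>B\<^esub> b) = J +>\<^bsub>T\<^esub> t \<and> (\<forall>w. length w \<ge> K \<longrightarrow> t w = 0)"
    if "F \<subseteq> S" for F a
    using finite_subset[OF that S(1)] that
  proof (induction F rule: finite_induct)
    case empty
    have J0: "0 \<in> J" using Jsub by (rule cfun.subspace_0)
    have "J +>\<^bsub>T\<^esub> 0 = J" by (rule T.a_coset_join2[OF subsetD[OF JT J0] Jgrp J0])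
    moreover have "\<zero>\<^bsub>B\<^esub> = J"
      by (simp add: B_def nichols_algebra_def quotient_algebra_def J_def)
    ultimately have "(\<Oplus>\<^bsub>B\<^esub>b\<in>{}. a b \<odot>\<^bsub>B\<^esub> b) = J +>\<^bsub>T\<^esub> 0" by simp
    moreover have "0 \<in> carrier T" using JT J0 by (rule subsetD)
    ultimately show ?case by fastforce
  next
    case (insert b F)
    then obtain t where t: "t \<in> carrier T" "(\<Oplus>\<^bsub>B\<^esub>b\<in>F. a b \<odot>\<^bsub>B\<^esub> b) = J +>\<^bsub>T\<^esub> t"
      "\<And>w. length w \<ge> K \<Longrightarrow> t w = 0" by auto
    have sc: "cscale (a x) (rep x) \<in> carrier T" if "x \<in> S" for x
      using rep(1) that Tsub cfun.subspace_scale by blast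
    have sB: "a x \<odot>\<^bsub>B\<^esub> x = J +>\<^bsub>T\<^esub> (cscale (a x) (rep x))" if "x \<in> S" for x
      using scale[OF rep(1)[OF that], of "a x"] rep(2)[OF that] by simp
    have "(\<Oplus>\<^bsub>B\<^esub>b\<in>insert b F. a b \<odot>\<^bsub>B\<^esub> b) = a b \<odot>\<^bsub>B\<^esub> b \<oplus>\<^bsub>B\<^esub> (\<Oplus>\<^bsub>B\<^esub>b\<in>F. a b \<odot>\<^bsub>B\<^esub> b)"
      using insert.prems by (intro B.finsum_insert insert.hyps) (auto simp: sB intro!: cosetB sc)
    also have "\<dots> = J +>\<^bsub>T\<^esub> (cscale (a b) (rep b) + t)"
      using insert.prems t sc by (simp add: sB add)
    finally have "(\<Oplus>\<^bsub>B\<^esub>b\<in>insert b F. a b \<odot>\<^bsub>B\<^esub> b) = J +>\<^bsub>T\<^esub> (cscale (a b) (rep b) + t)" .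
    moreover have "cscale (a b) (rep b) + t \<in> carrier T"
      using insert.prems t(1) sc cfun.subspace_add[OF Tsub] by blast
    moreover have "\<forall>w. length w \<ge> K \<longrightarrow> (cscale (a b) (rep b) + t) w = 0"
      using insert.prems t(3) bdK by (simp add: cscale_def)
    ultimately show ?case by blast
  qed
  show thesis
  proof (rule that)
    fix k t assume k: "k \<ge> K" and t: "t \<in> carrier (tensor_algebra M)"
    obtain a where "J +>\<^bsub>T\<^esub> t = (\<Oplus>\<^bsub>B\<^esub>b\<in>S. a b \<odot>\<^bsub>B\<^esub> b)"
      using span[OF cosetB] t unfolding T_def by blast
    with comb[of S a] obtain u where u: "u \<in> carrier T" "J +>\<^bsub>T\<^esub> t = J +>\<^bsub>T\<^esub> u"
      "\<And>w. length w \<ge> K \<Longrightarrow> u w = 0" by auto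
    have "t \<in> J +>\<^bsub>T\<^esub> t" using cfun.subspace_0[OF Jsub] by (auto simp: mem_coset)
    then obtain j where j: "j \<in> J" "t = j + u" unfolding u(2) by (auto simp: mem_coset)
    have "homogeneous_part k t = homogeneous_part k j"
      using u(3) k by (auto simp: homogeneous_part_def fun_eq_iff j(2))
    then show "quantum_symmetrizer c k (homogeneous_part k t) = 0"
      using j(1) by (simp add: J_def nichols_ideal_def)
  qed
qed

section \<open>Skew derivations of the tensor algebra\<close>

text \<open>Evaluated at a word \<open>a # u\<close>, the partial symmetrizer
  $1 + c_0 + c_0c_1 + \dots$ of a braiding $c\,t\,(p,q) = t(q, r\,q\,p)$ moves the letter \<open>a\<close> to
  every position of \<open>u\<close>, letting the letters that it passes act on it by \<open>r\<close>.  As a function of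
  \<open>t\<close> this is a skew derivation of the tensor algebra, contraction with the point evaluation
  at \<open>a\<close>; see \<open>braided_insertions_letter_mult\<close> for its Leibniz rule.\<close>

definition braided_insertions :: "('x \<Rightarrow> 'x \<Rightarrow> 'x) \<Rightarrow> 'x \<Rightarrow> ('x list \<Rightarrow> complex) \<Rightarrow> 'x list \<Rightarrow> complex" where
  "braided_insertions r a t u = (\<Sum>l\<le>length u. t (take l u @ fold r (take l u) a # drop l u))"

text \<open>The recursion of the quantum symmetrizer, read off at one word.\<close>

primrec symmetrized_value :: "('x \<Rightarrow> 'x \<Rightarrow> 'x) \<Rightarrow> 'x list \<Rightarrow> ('x list \<Rightarrow> complex) \<Rightarrow> complex" where
  "symmetrized_value r [] t = t []"
| "symmetrized_value r (a # u) t = symmetrized_value r u (braided_insertions r a t)"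

lemma sum_apply: "(\<Sum>j\<in>S. F j) x = (\<Sum>j\<in>S. F j x)" for F :: "'j \<Rightarrow> 'x \<Rightarrow> complex"
  by (induction S rule: infinite_finite_induct) auto

text \<open>The prefix \<open>v\<close> is there for the induction: the letter \<open>a\<close> has already been moved
  past the letters of \<open>v\<close>.\<close>

lemma braid_chain_value:
  assumes c: "\<And>p q t. p \<in> L \<Longrightarrow> q \<in> L \<Longrightarrow> c t (p, q) = t (q, r q p)"
    and r: "\<And>p q. p \<in> L \<Longrightarrow> q \<in> L \<Longrightarrow> r q p \<in> L"
    and "a \<in> L" "set u \<subseteq> L" "length v = m" "l \<le> length u"
  shows "foldr (braid_at c) [m..<m + l] t (v @ a # u) =
    t (v @ take l u @ fold r (take l u) a # drop l u)"
  using assms(3-)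
proof (induction l arbitrary: m v a u)
  case 0
  then show ?case by simp
next
  case (Suc l)
  then obtain b u' where u: "u = b # u'" by (cases u) auto
  have b: "b \<in> L" and u': "set u' \<subseteq> L" "l \<le> length u'" using Suc.prems u by auto
  have upt: "[m..<m + Suc l] = m # [Suc m..<Suc m + l]" by (simp add: upt_conv_Cons)
  have "foldr (braid_at c) [m..<m + Suc l] t (v @ a # u) =
      foldr (braid_at c) [Suc m..<Suc m + l] t ((v @ [b]) @ r b a # u')"
    unfolding upt u using Suc.prems(3) c[OF Suc.prems(1) b]
    by (simp add: braid_at_def nth_append list_update_append)
  also have "\<dots> = t ((v @ [b]) @ take l u' @ fold r (take l u') (r b a) # drop l u')"
    using Suc.prems r[OF Suc.prems(1) b] u' by (intro Suc.IH) auto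
  finally show ?case by (simp add: u)
qed

text \<open>The braiding needs to have the form $c\,t\,(p,q) = t(q, r\,q\,p)$ on the letters in \<open>L\<close> only,
  provided that \<open>r\<close> does not leave \<open>L\<close>; hence also the comparison of \<open>t\<close> with
  a \<open>t'\<close> that agrees with it on words over \<open>L\<close>.\<close>

lemma quantum_symmetrizer_value:
  assumes c: "\<And>p q t. p \<in> L \<Longrightarrow> q \<in> L \<Longrightarrow> c t (p, q) = t (q, r q p)"
    and r: "\<And>p q. p \<in> L \<Longrightarrow> q \<in> L \<Longrightarrow> r q p \<in> L"
    and "\<And>w. length w = k \<Longrightarrow> set w \<subseteq> L \<Longrightarrow> t w = t' w"
    and "length w = k" "set w \<subseteq> L"
  shows "quantum_symmetrizer c k t w = symmetrized_value r w t'"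
  using assms(3-)
proof (induction k arbitrary: t t' w)
  case 0
  then show ?case by simp
next
  case (Suc k)
  then obtain a u where w: "w = a # u" "a \<in> L" "set u \<subseteq> L" "length u = k" by (cases w) auto
  have "quantum_symmetrizer c k (\<lambda>v. (\<Sum>j\<le>k. foldr (braid_at c) [0..<j] t) (a # v)) u =
      symmetrized_value r u (braided_insertions r a t')"
  proof (rule Suc.IH)
    fix v assume v: "length v = k" "set v \<subseteq> L"
    have "foldr (braid_at c) [0..<j] t (a # v) =
        t' (take j v @ fold r (take j v) a # drop j v)" if "j \<le> k" for j
    proof -
      have fold_mem: "fold r xs b \<in> L" if "b \<in> L" "set xs \<subseteq> L" for b xs
        using that r by (induction xs arbitrary: b) auto
      have "foldr (braid_at c) [0..<0 + j] t ([] @ a # v) =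
          t ([] @ take j v @ fold r (take j v) a # drop j v)"
        using that v w(2) by (intro braid_chain_value[where L = L] c r) auto
      also have "\<dots> = t' (take j v @ fold r (take j v) a # drop j v)"
      proof -
        have "set (take j v) \<subseteq> L" "set (drop j v) \<subseteq> L"
          using v(2) set_take_subset set_drop_subset by fast+
        then show ?thesis using v(1) that w(2) fold_mem by (intro trans[OF Suc.prems(1)]) auto
      qed
      finally show ?thesis by simp
    qed
    then show "(\<Sum>j\<le>k. foldr (braid_at c) [0..<j] t) (a # v) = braided_insertions r a t' v"
      by (simp add: sum_apply braided_insertions_def v(1))
  qed (use w in auto)
  then show ?case by (simp add: w(1) on_tail_def)
qed

lemma braided_insertions_add:
  "braided_insertions r a (s + t) = braided_insertions r a s + braided_insertions r a t"
  by (auto simp: fun_eq_iff braided_insertions_def sum.distrib)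

lemma braided_insertions_scale:
  "braided_insertions r a (cscale b t) = cscale b (braided_insertions r a t)"
  by (auto simp: fun_eq_iff braided_insertions_def cscale_def sum_distrib_left)

lemma symmetrized_value_scale: "symmetrized_value r w (cscale b t) = b * symmetrized_value r w t"
  by (induction w arbitrary: t) (simp_all only: symmetrized_value.simps braided_insertions_scale,
    simp add: cscale_def)

text \<open>Left multiplication by a vector \<open>x\<close> in the tensor algebra.\<close>

definition letter_mult :: "('x \<Rightarrow> complex) \<Rightarrow> ('x list \<Rightarrow> complex) \<Rightarrow> 'x list \<Rightarrow> complex" where
  "letter_mult x t w = (case w of [] \<Rightarrow> 0 | a # u \<Rightarrow> x a * t u)"

abbreviation unit_tensor :: "'x list \<Rightarrow> complex" where
  "unit_tensor \<equiv> pure_tensor []"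

lemma letter_mult_add: "letter_mult x (s + t) = letter_mult x s + letter_mult x t"
  and letter_mult_scale: "letter_mult x (cscale b t) = cscale b (letter_mult x t)"
  and letter_mult_zero: "letter_mult x 0 = 0"
  by (auto simp: letter_mult_def cscale_def fun_eq_iff algebra_simps split: list.split)

lemma braided_insertions_unit: "braided_insertions r a unit_tensor = 0"
  by (auto simp: fun_eq_iff braided_insertions_def pure_tensor_def)

text \<open>The Leibniz rule: the letter \<open>a\<close> is either inserted in front of the word or has to
  pass the first letter \<open>b\<close>, which changes it to \<open>r b a\<close>.  When \<open>x\<close> is homogeneous for the
  coaction, \<open>r b a\<close> does not depend on the letter \<open>b\<close> in the support of \<open>x\<close>.\<close>

lemma braided_insertions_letter_mult:
  assumes "\<And>b. x b \<noteq> 0 \<Longrightarrow> r b a = a'"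
  shows "braided_insertions r a (letter_mult x t) =
    cscale (x a) t + letter_mult x (braided_insertions r a' t)"
proof
  fix u
  show "braided_insertions r a (letter_mult x t) u =
    (cscale (x a) t + letter_mult x (braided_insertions r a' t)) u"
  proof (cases u)
    case Nil
    then show ?thesis by (simp add: braided_insertions_def letter_mult_def cscale_def)
  next
    case (Cons b v)
    have "x b * t (take l v @ fold r (take l v) (r b a) # drop l v) =
        x b * t (take l v @ fold r (take l v) a' # drop l v)" for l
      using assms[of b] by (cases "x b = 0") auto
    then have "(\<Sum>l\<le>length v. x b * t (take l v @ fold r (take l v) (r b a) # drop l v)) =
        (\<Sum>l\<le>length v. x b * t (take l v @ fold r (take l v) a' # drop l v))"
      by (intro sum.cong refl)
    then show ?thesis
      unfolding Cons braided_insertions_def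
      by (simp add: letter_mult_def cscale_def sum.atMost_Suc_shift sum_distrib_left
        del: sum.atMost_Suc)
  qed
qed

text \<open>Here $c(x \otimes x) = x \otimes x$, so the quantum symmetrizer sums $m!$ copies of $x^m$:
  the skew derivation at a letter \<open>b\<close> maps $x^{m+1}$ to $(m+1)\,x(b)\,x^m$.\<close>

lemma symmetrized_value_power:
  assumes r: "\<And>a b. a \<in> L \<Longrightarrow> x b \<noteq> 0 \<Longrightarrow> r b a = \<phi> a"
    and \<phi>: "\<And>a. a \<in> L \<Longrightarrow> \<phi> a \<in> L" "\<And>a. a \<in> L \<Longrightarrow> x (\<phi> a) = x a"
    and a: "a \<in> L"
  shows "symmetrized_value r (replicate m a) ((letter_mult x ^^ m) unit_tensor) = fact m * x a ^ m"
proof -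
  have D: "braided_insertions r b ((letter_mult x ^^ Suc m) unit_tensor) =
      cscale (of_nat (Suc m) * x b) ((letter_mult x ^^ m) unit_tensor)" if "b \<in> L" for b m
    using that
  proof (induction m arbitrary: b)
    case 0
    have "braided_insertions r b (letter_mult x unit_tensor) =
        cscale (x b) unit_tensor + letter_mult x (braided_insertions r (\<phi> b) unit_tensor)"
      using r 0 by (intro braided_insertions_letter_mult) auto
    then show ?case by (simp add: braided_insertions_unit letter_mult_zero)
  next
    case (Suc m)
    have "braided_insertions r b ((letter_mult x ^^ Suc (Suc m)) unit_tensor) =
        cscale (x b) ((letter_mult x ^^ Suc m) unit_tensor) +
        letter_mult x (braided_insertions r (\<phi> b) ((letter_mult x ^^ Suc m) unit_tensor))"
      unfolding funpow.simps(2)[of "Suc m"] o_apply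
      using r Suc.prems by (intro braided_insertions_letter_mult) auto
    also have "\<dots> = cscale (x b) ((letter_mult x ^^ Suc m) unit_tensor) +
        letter_mult x (cscale (of_nat (Suc m) * x b) ((letter_mult x ^^ m) unit_tensor))"
      unfolding Suc.IH[OF \<phi>(1)[OF Suc.prems]] \<phi>(2)[OF Suc.prems] ..
    also have "\<dots> = cscale (of_nat (Suc (Suc m)) * x b) ((letter_mult x ^^ Suc m) unit_tensor)"
      unfolding letter_mult_scale by (auto simp: cscale_def fun_eq_iff algebra_simps)
    finally show ?case .
  qed
  show ?thesis
  proof (induction m)
    case 0
    show ?case by (simp add: pure_tensor_def)
  next
    case (Suc m)
    have "symmetrized_value r (replicate (Suc m) a) ((letter_mult x ^^ Suc m) unit_tensor) =
        of_nat (Suc m) * x a * symmetrized_value r (replicate m a) ((letter_mult x ^^ m) unit_tensor)"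
      unfolding replicate_Suc symmetrized_value.simps D[OF a] symmetrized_value_scale ..
    then show ?case by (simp add: Suc algebra_simps)
  qed
qed

text \<open>Left multiplication by $xy - p\,yx$.\<close>

definition skew_commutator ::
    "complex \<Rightarrow> ('x \<Rightarrow> complex) \<Rightarrow> ('x \<Rightarrow> complex) \<Rightarrow> ('x list \<Rightarrow> complex) \<Rightarrow> 'x list \<Rightarrow> complex" where
  "skew_commutator p x y t =
    letter_mult x (letter_mult y t) + cscale (- p) (letter_mult y (letter_mult x t))"

lemma skew_commutator_scale:
    "skew_commutator p x y (cscale b t) = cscale b (skew_commutator p x y t)"
  and skew_commutator_zero: "skew_commutator p x y 0 = 0"
  unfolding skew_commutator_def letter_mult_add letter_mult_scale letter_mult_zero
  by (auto simp: fun_eq_iff cscale_def algebra_simps)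

text \<open>Let $z = xy - p\,yx$, and let $\partial_d$ be the skew derivation at the letter $d$.  The terms
  with \<open>y d\<close> cancel, and $\phi\psi = 1$ makes $z$ of trivial coaction degree, so that
  $\partial_d(zt) = (1-p^2)\,x(d)\,y\,t + z\,\partial_d t$.  Hence $\partial_d z^m = x(d)\,Y_m$ with
  $Y_{m+1} = (1-p^2)\,y z^m + z Y_m$.  Since \<open>x b = 0\<close>, only the leading letter $y$ of each
  summand contributes to $\partial_b Y_m = m(1-p^2)\,y(b)\,z^{m-1}$.  Applying $\partial_a$ and
  $\partial_b$ in turn therefore lowers the exponent of $z$ by one and never gives zero
  unless one of the displayed factors vanishes.\<close>

lemma symmetrized_value_skew_commutator_power:
  assumes rx: "\<And>a b. a \<in> L \<Longrightarrow> x b \<noteq> 0 \<Longrightarrow> r b a = \<phi> a"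
    and ry: "\<And>a b. a \<in> L \<Longrightarrow> y b \<noteq> 0 \<Longrightarrow> r b a = \<psi> a"
    and mem: "\<And>a. a \<in> L \<Longrightarrow> \<phi> a \<in> L" "\<And>a. a \<in> L \<Longrightarrow> \<psi> a \<in> L"
    and inverse: "\<And>a. a \<in> L \<Longrightarrow> \<psi> (\<phi> a) = a" "\<And>a. a \<in> L \<Longrightarrow> \<phi> (\<psi> a) = a"
    and py: "\<And>a. a \<in> L \<Longrightarrow> y (\<phi> a) = p * y a"
    and px: "\<And>a. a \<in> L \<Longrightarrow> x (\<psi> a) = p * x a"
    and a: "a \<in> L" and b: "b \<in> L" "x b = 0"
  shows "symmetrized_value r (concat (replicate m [a, b])) ((skew_commutator p x y ^^ m) unit_tensor) =
    fact m * ((1 - p\<^sup>2) * x a * y b) ^ m"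
proof -
  let ?z = "skew_commutator p x y"
  let ?D = "braided_insertions r"
  have Dx: "?D d (letter_mult x t) = cscale (x d) t + letter_mult x (?D (\<phi> d) t)" if "d \<in> L" for d t
    using rx that by (intro braided_insertions_letter_mult) auto
  have Dy: "?D d (letter_mult y t) = cscale (y d) t + letter_mult y (?D (\<psi> d) t)" if "d \<in> L" for d t
    using ry that by (intro braided_insertions_letter_mult) auto
  have Dz: "?D d (?z t) = cscale ((1 - p\<^sup>2) * x d) (letter_mult y t) + ?z (?D d t)"
    if d: "d \<in> L" for d t
  proof -
    have "?D d (?z t) = cscale (x d) (letter_mult y t) +
        letter_mult x (cscale (y (\<phi> d)) t + letter_mult y (?D (\<psi> (\<phi> d)) t)) +
        cscale (- p) (cscale (y d) (letter_mult x t) +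
          letter_mult y (cscale (x (\<psi> d)) t + letter_mult x (?D (\<phi> (\<psi> d)) t)))"
      using d mem by (simp add: skew_commutator_def braided_insertions_add braided_insertions_scale Dx Dy
        del: cfun.scale_minus_left)
    also have "\<dots> = cscale ((1 - p\<^sup>2) * x d) (letter_mult y t) + ?z (?D d t)"
      unfolding inverse[OF d] px[OF d] py[OF d] letter_mult_add letter_mult_scale skew_commutator_def
      by (auto simp: fun_eq_iff cscale_def power2_eq_square algebra_simps)
    finally show ?thesis .
  qed
  define Z where "Z m = (?z ^^ m) unit_tensor" for m
  define Y where "Y = rec_nat 0 (\<lambda>m t. cscale (1 - p\<^sup>2) (letter_mult y (Z m)) + ?z t)"
  have Y: "Y 0 = 0" "Y (Suc m) = cscale (1 - p\<^sup>2) (letter_mult y (Z m)) + ?z (Y m)" for m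
    by (auto simp: Y_def)
  have ZS: "Z (Suc m) = ?z (Z m)" for m by (simp add: Z_def)
  have DZ: "?D d (Z m) = cscale (x d) (Y m)" if "d \<in> L" for d m
  proof (induction m)
    case 0
    show ?case by (simp add: Z_def Y braided_insertions_unit cscale_def zero_fun_def)
  next
    case (Suc m)
    have "?D d (Z (Suc m)) = cscale ((1 - p\<^sup>2) * x d) (letter_mult y (Z m)) + cscale (x d) (?z (Y m))"
      unfolding ZS Dz[OF that] Suc.IH skew_commutator_scale ..
    then show ?case by (auto simp: Y cscale_def fun_eq_iff algebra_simps)
  qed
  have DY: "?D b (Y m) = cscale (of_nat m * (1 - p\<^sup>2) * y b) (Z (m - 1))" for m
  proof (induction m)
    case 0
    show ?case by (simp add: Y fun_eq_iff cscale_def braided_insertions_def)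
  next
    case (Suc m)
    have "?D b (letter_mult y (Z m)) = cscale (y b) (Z m)"
      using Dy[OF b(1), of "Z m"] DZ[of "\<psi> b" m] mem b px[OF b(1)]
      by (simp add: letter_mult_zero cscale_def fun_eq_iff letter_mult_def split: list.split)
    moreover have "?D b (?z (Y m)) = cscale (of_nat m * (1 - p\<^sup>2) * y b) (Z m)"
    proof (cases m)
      case 0
      have "?D b 0 = 0" by (simp add: fun_eq_iff braided_insertions_def)
      then show ?thesis
        unfolding 0 Y skew_commutator_zero by (simp add: fun_eq_iff cscale_def)
    next
      case (Suc m')
      then show ?thesis using Dz[OF b(1), of "Y m"] b(2) Suc.IH
        by (simp add: skew_commutator_scale ZS)
    qed
    ultimately have "?D b (Y (Suc m)) = cscale (1 - p\<^sup>2) (cscale (y b) (Z m)) +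
        cscale (of_nat m * (1 - p\<^sup>2) * y b) (Z m)"
      unfolding Y braided_insertions_add braided_insertions_scale by (simp only:)
    then show ?case by (auto simp: fun_eq_iff cscale_def algebra_simps)
  qed
  have "symmetrized_value r (concat (replicate m [a, b])) (Z m) = fact m * ((1 - p\<^sup>2) * x a * y b) ^ m"
  proof (induction m)
    case 0
    show ?case by (simp add: Z_def pure_tensor_def)
  next
    case (Suc m)
    have "symmetrized_value r (concat (replicate (Suc m) [a, b])) (Z (Suc m)) =
        x a * (of_nat (Suc m) * (1 - p\<^sup>2) * y b *
          symmetrized_value r (concat (replicate m [a, b])) (Z m))"
      by (simp only: replicate_Suc concat.simps append_Cons append_Nil symmetrized_value.simps
        DZ[OF a] DY braided_insertions_scale symmetrized_value_scale diff_Suc_1)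
    then show ?case by (simp add: Suc)
  qed
  then show ?thesis by (simp add: Z_def)
qed

lemma letter_mult_mem_tensor_algebra:
  assumes x: "x \<in> M" and t: "t \<in> carrier (tensor_algebra M)"
  shows "letter_mult x t \<in> carrier (tensor_algebra M)"
proof -
  have "t \<in> cfun.span {pure_tensor xs | xs. set xs \<subseteq> M}" using t by (simp add: tensor_algebra_def)
  then have "letter_mult x t \<in> cfun.span {pure_tensor xs | xs. set xs \<subseteq> M}"
  proof (induction rule: cfun.span_induct_alt)
    case base
    show ?case unfolding letter_mult_zero by (rule cfun.span_zero)
  next
    case (step a s t)
    then obtain xs where xs: "s = pure_tensor xs" "set xs \<subseteq> M" by auto
    have "letter_mult x s = pure_tensor (x # xs)"
      by (auto simp: fun_eq_iff letter_mult_def pure_tensor_def xs(1) prod.lessThan_Suc_shift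
        simp del: prod.lessThan_Suc split: list.split)
    then have "letter_mult x s \<in> cfun.span {pure_tensor xs | xs. set xs \<subseteq> M}"
      using x xs(2) by (intro cfun.span_base) (auto intro!: exI[of _ "x # xs"])
    then show ?case
      unfolding letter_mult_add letter_mult_scale
      by (intro cfun.span_add cfun.span_scale step.IH)
  qed
  then show ?thesis by (simp add: tensor_algebra_def)
qed

lemma unit_tensor_mem_tensor_algebra: "unit_tensor \<in> carrier (tensor_algebra M)"
  by (auto simp: tensor_algebra_def intro!: cfun.span_base exI[of _ "[]"])

lemma skew_commutator_mem_tensor_algebra:
  assumes "x \<in> M" "y \<in> M" "t \<in> carrier (tensor_algebra M)"
  shows "skew_commutator p x y t \<in> carrier (tensor_algebra M)"
  unfolding skew_commutator_def
  by (intro cfun.subspace_add[OF tensor_algebra_subspace] cfun.subspace_scale[OF tensor_algebra_subspace]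
    letter_mult_mem_tensor_algebra assms)

section \<open>Nichols algebras of conjugacy classes\<close>

text \<open>The letter \<open>p\<close> is translated by the inverse of the degree of \<open>q\<close>, because
  $g \in G$ acts on functions by $(g \cdot f)(k) = f(g^{-1}k)$.\<close>

definition translate_back :: "'g monoid \<Rightarrow> 'g \<Rightarrow> 'g \<times> 'i \<Rightarrow> 'g \<times> 'i \<Rightarrow> 'g \<times> 'i" where
  "translate_back G s q p = (inv\<^bsub>G\<^esub> (conj_by G (fst q) s) \<otimes>\<^bsub>G\<^esub> fst p, snd p)"

definition supported_on :: "nat \<Rightarrow> 'x set \<Rightarrow> ('x list \<Rightarrow> complex) \<Rightarrow> bool" where
  "supported_on k L t \<longleftrightarrow> (\<forall>w. t w \<noteq> 0 \<longrightarrow> length w = k \<and> set w \<subseteq> L)"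

lemma class_braiding_apply:
  assumes "finite (carrier G)"
  shows "class_braiding G s t (p, q) =
    (if fst p \<in> carrier G \<and> conj_by G (fst q) s \<in> carrier G then t (q, translate_back G s q p) else 0)"
proof -
  have "class_braiding G s t (p, q) =
      (\<Sum>g\<in>carrier G. on_left (ind_act G g) (flip (on_left (class_coaction G s g) t)) (p, q))"
    unfolding class_braiding_def yd_braiding_def by (rule sum_apply)
  also have "\<dots> = (\<Sum>g\<in>carrier G. if conj_by G (fst q) s = g
      then if fst p \<in> carrier G then t (q, translate_back G s q p) else 0 else 0)"
    by (intro sum.cong refl)
      (auto simp: on_left_def ind_act_def flip_def class_coaction_def translate_back_def
        split: prod.splits)
  also have "\<dots> = (if fst p \<in> carrier G \<and> conj_by G (fst q) s \<in> carrier G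
      then t (q, translate_back G s q p) else 0)"
    using assms by (simp add: sum.delta')
  finally show ?thesis .
qed

lemma linear_operator_class_braiding:
  assumes "finite (carrier G)"
  shows "linear_operator (class_braiding G s)"
  by (auto simp: linear_operator_def fun_eq_iff class_braiding_apply[OF assms] cscale_def)

lemma class_braiding_letters:
  assumes "group G" "finite (carrier G)" "s \<in> carrier G"
    and "p \<in> carrier G \<times> UNIV" "q \<in> carrier G \<times> UNIV"
  shows "class_braiding G s t (p, q) = t (q, translate_back G s q p)"
    and "translate_back G s q p \<in> carrier G \<times> UNIV"
proof -
  interpret group G by (fact assms(1))
  show "class_braiding G s t (p, q) = t (q, translate_back G s q p)"
    and "translate_back G s q p \<in> carrier G \<times> UNIV"
    using assms(3-)
    by (auto simp: class_braiding_apply[OF assms(2)] conj_by_def translate_back_def)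
qed

lemma supported_on_braid_at:
  assumes c: "\<And>t p q. c t (p, q) \<noteq> 0 \<Longrightarrow> p \<in> L \<and> t (q, r q p) \<noteq> 0" and t: "supported_on k L t"
  shows "supported_on k L (braid_at c j t)"
  unfolding supported_on_def
proof (intro allI impI)
  fix w assume nz: "braid_at c j t w \<noteq> 0"
  then have j: "Suc j < length w"
    and cnz: "c (\<lambda>(a, b). t (w[j := a, Suc j := b])) (w ! j, w ! Suc j) \<noteq> 0"
    by (auto simp: braid_at_def split: if_splits)
  let ?w = "w[j := w ! Suc j, Suc j := r (w ! Suc j) (w ! j)]"
  have p: "w ! j \<in> L" and "t ?w \<noteq> 0" using c[OF cnz] by auto
  then have len: "length w = k" and sub: "set ?w \<subseteq> L" using t by (auto simp: supported_on_def)
  have "w ! i \<in> L" if i: "i < length w" for i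
  proof (cases "i = j")
    case True
    then show ?thesis using p by simp
  next
    case False
    define m where "m = (if i = Suc j then j else i)"
    have "?w ! m = w ! i" "m < length ?w" using False i j by (auto simp: m_def)
    then show ?thesis using sub nth_mem[of m ?w] by auto
  qed
  then show "length w = k \<and> set w \<subseteq> L" using len by (auto simp: in_set_conv_nth)
qed

text \<open>Outside the words over \<open>L\<close> of length \<open>k\<close> the formula of
  \<open>quantum_symmetrizer_value\<close> is not available; there a symmetrized tensor vanishes if the tensor itself does.\<close>

lemma supported_on_quantum_symmetrizer:
  assumes c: "\<And>t p q. c t (p, q) \<noteq> 0 \<Longrightarrow> p \<in> L \<and> t (q, r q p) \<noteq> 0" and lin: "linear_operator c"
  shows "supported_on k L t \<Longrightarrow> supported_on k L (quantum_symmetrizer c k t)"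
proof (induction k arbitrary: t)
  case 0
  then show ?case by simp
next
  case (Suc k)
  have "supported_on (Suc k) L (braid_at c j u)" if "supported_on (Suc k) L u" for j u
    using that by (rule supported_on_braid_at[where c = c and r = r, rotated]) (rule c)
  then have "supported_on (Suc k) L (foldr (braid_at c) js t)" for js
    using Suc.prems by (induction js) auto
  from this[of "[0..<_]"] have T: "supported_on (Suc k) L (\<Sum>j\<le>k. foldr (braid_at c) [0..<j] t)"
    (is "supported_on _ _ ?T")
    unfolding supported_on_def sum_apply using sum.not_neutral_contains_not_neutral by blast
  define S where "S = ?T"
  have S: "length (a # v) = Suc k \<and> set (a # v) \<subseteq> L" if "S (a # v) \<noteq> 0" for a v
    using T that unfolding S_def supported_on_def by blast
  show ?case
    unfolding supported_on_def
  proof (intro allI impI)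
    fix w assume "quantum_symmetrizer c (Suc k) t w \<noteq> 0"
    then obtain a u where w: "w = a # u"
      and nz: "quantum_symmetrizer c k (\<lambda>v. S (a # v)) u \<noteq> 0"
      unfolding S_def by (cases w) (auto simp: on_tail_def)
    have "supported_on k L (\<lambda>v. S (a # v))" using S unfolding supported_on_def by auto
    then have "supported_on k L (quantum_symmetrizer c k (\<lambda>v. S (a # v)))" by (rule Suc.IH)
    then have "length u = k \<and> set u \<subseteq> L" using nz unfolding supported_on_def by blast
    moreover have "a \<in> L"
    proof (rule ccontr)
      assume "a \<notin> L"
      then have "(\<lambda>v. S (a # v)) = 0" using S by (auto simp: fun_eq_iff)
      then show False
        using nz linear_operator_zero[OF linear_operator_quantum_symmetrizer[OF lin]] by simp
    qed
    ultimately show "length w = Suc k \<and> set w \<subseteq> L" using w by simp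
  qed
qed

lemma skew_commutator_nonzero:
  assumes "skew_commutator p x y t w \<noteq> 0"
  shows "\<exists>a b u. w = a # b # u \<and> t u \<noteq> 0"
proof (cases w)
  case (Cons a v)
  then show ?thesis
    using assms
    by (cases v) (auto simp: skew_commutator_def letter_mult_def cscale_def)
qed (use assms in \<open>simp add: skew_commutator_def letter_mult_def cscale_def\<close>)

text \<open>Parametricity, used to compare the braidings of two classes on tensors that do not
  distinguish letters related by \<open>E\<close>.\<close>

lemma symmetrized_value_parametric:
  assumes r: "\<And>p p' q q'. E p p' \<Longrightarrow> E q q' \<Longrightarrow> E (r q p) (r' q' p')"
    and t: "\<And>u u'. list_all2 E u u' \<Longrightarrow> t u = t' u'" and w: "list_all2 E w w'"
  shows "symmetrized_value r w t = symmetrized_value r' w' t'"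
  using w t
proof (induction w w' arbitrary: t t' rule: list_all2_induct)
  case Nil
  then show ?case by simp
next
  case (Cons a w a' w')
  have fold: "E (fold r u a) (fold r' u' a')" if "list_all2 E u u'" "E a a'" for u u' a a'
    using that by (induction u u' arbitrary: a a' rule: list_all2_induct) (auto intro: r)
  have "braided_insertions r a t u = braided_insertions r' a' t' u'" if u: "list_all2 E u u'" for u u'
    unfolding braided_insertions_def list_all2_lengthD[OF u]
    by (intro sum.cong refl Cons.prems list_all2_appendI list.rel_intros fold
      list_all2_takeI list_all2_dropI u Cons.hyps)
  then have "symmetrized_value r w (braided_insertions r a t) =
      symmetrized_value r' w' (braided_insertions r' a' t')" by (rule Cons.IH)
  then show ?case by simp
qed

context
  fixes G :: "'g monoid" and s :: 'g and W :: "('i \<Rightarrow> complex) set"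
    and \<rho> :: "'g \<Rightarrow> ('i \<Rightarrow> complex) \<Rightarrow> ('i \<Rightarrow> complex)"
  assumes G: "group G" and fin: "finite (carrier G)" and s: "s \<in> carrier G"
    and \<rho>: "representation (centralizer G s) W \<rho>"
begin

interpretation group G by (fact G)

private abbreviation "K \<equiv> {g \<in> carrier G. g \<otimes>\<^bsub>G\<^esub> s = s \<otimes>\<^bsub>G\<^esub> g}"
lemmas subgroup_K = centralizer_subgroup[OF G s]

private abbreviation "letters \<equiv> carrier G \<times> (UNIV :: 'i set)"

text \<open>The criterion for infinite dimension: tensors of unbounded degree on which the quantum
  symmetrizer does not vanish, as witnessed by one word each.\<close>

lemma not_finite_dimensional_class_nichols:
  assumes mem: "\<And>m. Z m \<in> carrier (tensor_algebra (class_module G s W \<rho>))"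
    and w: "\<And>m. set (w m) \<subseteq> letters" "\<And>m. m \<le> length (w m)"
    and supp: "\<And>m v. Z m v \<noteq> 0 \<Longrightarrow> length v = length (w m)"
    and nz: "\<And>m. symmetrized_value (translate_back G s) (w m) (Z m) \<noteq> 0"
  shows "\<not> finite_dimensional (class_nichols_algebra G s W \<rho>)"
proof
  assume "finite_dimensional (class_nichols_algebra G s W \<rho>)"
  then obtain k where k: "\<And>l t. k \<le> l \<Longrightarrow> t \<in> carrier (tensor_algebra (class_module G s W \<rho>)) \<Longrightarrow>
      quantum_symmetrizer (class_braiding G s) l (homogeneous_part l t) = 0"
    unfolding class_nichols_algebra_def
    by (rule finite_dimensional_nichols_bounded[OF linear_operator_class_braiding[OF fin]]) blast
  define l where "l = length (w k)"
  have "homogeneous_part l (Z k) = Z k"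
    using supp[of k] by (auto simp: homogeneous_part_def l_def fun_eq_iff)
  then have "quantum_symmetrizer (class_braiding G s) l (Z k) (w k) = 0"
    using k[of l "Z k"] mem w(2)[of k] by (simp add: l_def)
  moreover have "quantum_symmetrizer (class_braiding G s) l (Z k) (w k) =
      symmetrized_value (translate_back G s) (w k) (Z k)"
    by (rule quantum_symmetrizer_value[OF class_braiding_letters[OF G fin s]])
      (auto simp: l_def w(1))
  ultimately show False using nz by simp
qed

text \<open>The vectors $x = 1 \otimes v$ and $y = h \otimes v$ have degrees $s$ and $s^{-1}$, and $s$ acts
  on them by $q$ and $q^{-1}$.  If $q = 1$, the powers of $x$ are nonzero in the Nichols algebra.
  If $q^2 \neq 1$, the powers of $xy - q^{-1}yx$ are: $h$ does not centralize $s$ in this case,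
  since $s = s^{-1}$ would give $q^2 = 1$, so the letter \<open>(h, i)\<close> lies outside the support
  of $x$.\<close>

lemma eigenvalue_minus_one_of_finite_dimensional:
  assumes v: "v \<in> W" "v \<noteq> 0" "\<rho> s v = cscale q v"
    and h: "h \<in> carrier G" "conj_by G h s = inv\<^bsub>G\<^esub> s"
    and fd: "finite_dimensional (class_nichols_algebra G s W \<rho>)"
  shows "q = - 1"
proof (rule ccontr)
  assume q: "q \<noteq> - 1"
  have cent: "centralizer G s = G\<lparr>carrier := K\<rparr>" by (simp add: centralizer_def)
  note \<rho>K = \<rho>[unfolded cent]
  have sK: "s \<in> K" using s by simp
  have mult: "\<rho> (g \<otimes>\<^bsub>G\<^esub> k) u = \<rho> g (\<rho> k u)" if "g \<in> K" "k \<in> K" "u \<in> W" for g k u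
    using \<rho>K that by (auto simp: representation_def)
  have \<rho>_one: "\<rho> \<one>\<^bsub>G\<^esub> u = u" if "u \<in> W" for u using \<rho>K that by (auto simp: representation_def)
  have scale: "\<rho> k (cscale a u) = cscale a (\<rho> k u)" if "k \<in> K" "u \<in> W" for k a u
    using \<rho>K that by (auto simp: representation_def linear_map_on_def)
  define T where "T g = ind_tensor G (centralizer G s) \<rho> g v" for g
  have Tmem: "T g \<in> class_module G s W \<rho>" if "g \<in> carrier G" for g
    unfolding T_def class_module_def cent
    by (rule ind_tensor_in_ind_space[OF G subgroup_K \<rho>K that v(1)])
  have Tq: "T (g \<otimes>\<^bsub>G\<^esub> s) = cscale q (T g)" if "g \<in> carrier G" for g
  proof -
    have "inv\<^bsub>G\<^esub> k \<in> K" if "k \<in> K" for k using subgroup_K that subgroup.m_inv_closed by metis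
    then have "ind_tensor G (G\<lparr>carrier := K\<rparr>) \<rho> g (cscale q v) =
        cscale q (ind_tensor G (G\<lparr>carrier := K\<rparr>) \<rho> g v)"
      using scale v(1) by (fastforce simp: ind_tensor_def fun_eq_iff cscale_def)
    then show ?thesis
      using ind_tensor_balanced[OF G subgroup_K \<rho>K that sK v(1)]
      by (simp add: T_def cent v(3))
  qed
  have Tact: "T g (inv\<^bsub>G\<^esub> x \<otimes>\<^bsub>G\<^esub> a, i) = T (x \<otimes>\<^bsub>G\<^esub> g) (a, i)"
    if "g \<in> carrier G" "x \<in> carrier G" "a \<in> carrier G" for g x a i
    using fun_cong[OF ind_act_ind_tensor[OF G subgroup_K \<rho>K that(2,1), of v], of "(a, i)"] that
    by (simp add: T_def cent ind_act_def)
  have Tdeg: "conj_by G (fst b) s = conj_by G g s" if "T g b \<noteq> 0" "g \<in> carrier G" for g b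
  proof -
    have "class_coaction G s (conj_by G (fst b) s) (T g) b = T g b"
      by (cases b) (simp add: class_coaction_def)
    then show ?thesis
      using that class_coaction_ind_tensor[OF G s that(2), of "conj_by G (fst b) s" \<rho> v]
      by (auto simp: T_def split: if_splits)
  qed
  define x where "x = T \<one>\<^bsub>G\<^esub>"
  define y where "y = T h"
  have conj1: "conj_by G \<one>\<^bsub>G\<^esub> s = s" using s by (simp add: conj_by_def)
  have hs: "h \<otimes>\<^bsub>G\<^esub> s = inv\<^bsub>G\<^esub> s \<otimes>\<^bsub>G\<^esub> h"
  proof -
    have "h \<otimes>\<^bsub>G\<^esub> s = conj_by G h s \<otimes>\<^bsub>G\<^esub> h" using h(1) s by (simp add: conj_by_def m_assoc)
    then show ?thesis by (simp add: h(2))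
  qed
  have x_up: "x (inv\<^bsub>G\<^esub> s \<otimes>\<^bsub>G\<^esub> a, i) = q * x (a, i)" if "a \<in> carrier G" for a i
    using Tact[of "\<one>\<^bsub>G\<^esub>" s a i] Tq[of "\<one>\<^bsub>G\<^esub>"] that s by (simp add: x_def cscale_def)
  have y_up: "y (s \<otimes>\<^bsub>G\<^esub> a, i) = q * y (a, i)" if "a \<in> carrier G" for a i
    using Tact[of h "inv\<^bsub>G\<^esub> s" a i] Tq[of h] that s h(1) by (simp add: y_def cscale_def hs)
  have q0: "q \<noteq> 0"
  proof
    assume "q = 0"
    then have "\<rho> s v = cscale 0 v" using v(3) by simp
    moreover have "\<rho> (inv\<^bsub>G\<^esub> s \<otimes>\<^bsub>G\<^esub> s) v = \<rho> (inv\<^bsub>G\<^esub> s) (\<rho> s v)"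
      using s v(1) subgroup_K subgroup.m_inv_closed[OF subgroup_K sK]
      by (intro mult) auto
    ultimately have "v = cscale 0 (\<rho> (inv\<^bsub>G\<^esub> s) v)"
      using scale[OF subgroup.m_inv_closed[OF subgroup_K sK] v(1), of 0] s \<rho>_one[OF v(1)]
      by simp
    then show False using v(2) by (simp add: cscale_def zero_fun_def)
  qed
  have x_down: "x (s \<otimes>\<^bsub>G\<^esub> a, i) = inverse q * x (a, i)" if "a \<in> carrier G" for a i
    using x_up[of "s \<otimes>\<^bsub>G\<^esub> a" i] that s q0 by (simp add: m_assoc[symmetric])
  have y_down: "y (inv\<^bsub>G\<^esub> s \<otimes>\<^bsub>G\<^esub> a, i) = inverse q * y (a, i)" if "a \<in> carrier G" for a i
    using y_up[of "inv\<^bsub>G\<^esub> s \<otimes>\<^bsub>G\<^esub> a" i] that s q0 by (simp add: m_assoc[symmetric])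
  define \<phi> where "\<phi> = (\<lambda>p :: 'g \<times> 'i. (inv\<^bsub>G\<^esub> s \<otimes>\<^bsub>G\<^esub> fst p, snd p))"
  define \<psi> where "\<psi> = (\<lambda>p :: 'g \<times> 'i. (s \<otimes>\<^bsub>G\<^esub> fst p, snd p))"
  have rx: "translate_back G s b a = \<phi> a" if "x b \<noteq> 0" for a b
    using Tdeg[of "\<one>\<^bsub>G\<^esub>" b] that by (simp add: x_def translate_back_def \<phi>_def conj1)
  have ry: "translate_back G s b a = \<psi> a" if "y b \<noteq> 0" for a b
    using Tdeg[of h b] that s h by (simp add: y_def translate_back_def \<psi>_def)
  have mem: "\<phi> a \<in> letters" "\<psi> a \<in> letters" if "a \<in> letters" for a
    using that s by (auto simp: \<phi>_def \<psi>_def)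
  have xM: "x \<in> class_module G s W \<rho>" and yM: "y \<in> class_module G s W \<rho>"
    using Tmem h(1) by (auto simp: x_def y_def)
  obtain i where i: "v i \<noteq> 0" using v(2) by (auto simp: fun_eq_iff)
  have x1: "x (\<one>\<^bsub>G\<^esub>, i) = v i" using s \<rho>_one[OF v(1)]
    by (simp add: x_def T_def ind_tensor_def centralizer_def)
  have y1: "y (h, i) = v i" using s \<rho>_one[OF v(1)] h(1)
    by (simp add: y_def T_def ind_tensor_def centralizer_def)
  show False
  proof (cases "q = 1")
    case True
    let ?Z = "\<lambda>m. (letter_mult x ^^ m) unit_tensor"
    have "symmetrized_value (translate_back G s) (replicate m (\<one>\<^bsub>G\<^esub>, i)) (?Z m) =
        fact m * x (\<one>\<^bsub>G\<^esub>, i) ^ m" for m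
      by (rule symmetrized_value_power[where L = letters and \<phi> = \<phi>])
        (use mem rx x_up True in \<open>auto simp: \<phi>_def\<close>)
    moreover have "?Z m \<in> carrier (tensor_algebra (class_module G s W \<rho>))" for m
      by (induction m) (auto intro: letter_mult_mem_tensor_algebra xM unit_tensor_mem_tensor_algebra)
    moreover have "length w = m" if "?Z m w \<noteq> 0" for m w
      using that
      by (induction m arbitrary: w)
        (auto simp: letter_mult_def pure_tensor_def split: list.splits if_splits)
    ultimately have "\<not> finite_dimensional (class_nichols_algebra G s W \<rho>)"
      by (intro not_finite_dimensional_class_nichols[of ?Z "\<lambda>m. replicate m (\<one>\<^bsub>G\<^esub>, i)"])
        (auto simp: x1 i)
    with fd show False by contradiction
  next
    case False
    then have q2: "(inverse q)\<^sup>2 \<noteq> 1"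
      using q by (metis inverse_1 inverse_inverse_eq inverse_minus_eq power2_eq_1_iff)
    let ?Z = "\<lambda>m. (skew_commutator (inverse q) x y ^^ m) unit_tensor"
    have x0: "x (h, i) = 0"
    proof (rule ccontr)
      assume "x (h, i) \<noteq> 0"
      then have "conj_by G h s = s" using Tdeg[of "\<one>\<^bsub>G\<^esub>" "(h, i)"] by (simp add: x_def conj1)
      then have "s \<otimes>\<^bsub>G\<^esub> s = \<one>\<^bsub>G\<^esub>" using h(2) s by (metis r_inv)
      then have "v = \<rho> s (\<rho> s v)" using mult[OF sK sK v(1)] \<rho>_one[OF v(1)] by simp
      also have "\<dots> = cscale (q\<^sup>2) v"
        using scale[OF sK v(1), of q] by (simp add: v(3) power2_eq_square)
      finally have "v i = q\<^sup>2 * v i" by (metis cscale_def)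
      then have "q\<^sup>2 = 1" using i by simp
      then show False using q False power2_eq_1_iff by blast
    qed
    have "symmetrized_value (translate_back G s) (concat (replicate m [(\<one>\<^bsub>G\<^esub>, i), (h, i)])) (?Z m) =
        fact m * ((1 - (inverse q)\<^sup>2) * x (\<one>\<^bsub>G\<^esub>, i) * y (h, i)) ^ m" for m
      by (rule symmetrized_value_skew_commutator_power[where L = letters and \<phi> = \<phi> and \<psi> = \<psi>])
        (use mem rx ry x_down y_down s h(1) x0 in
          \<open>auto simp: \<phi>_def \<psi>_def m_assoc[symmetric]\<close>)
    moreover have "?Z m \<in> carrier (tensor_algebra (class_module G s W \<rho>))" for m
      by (induction m)
        (auto intro: skew_commutator_mem_tensor_algebra xM yM unit_tensor_mem_tensor_algebra)
    moreover have "length w = 2 * m" if "?Z m w \<noteq> 0" for m w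
      using that
    proof (induction m arbitrary: w)
      case (Suc m)
      then obtain a b u where w: "w = a # b # u" and "?Z m u \<noteq> 0"
        using skew_commutator_nonzero[of "inverse q" x y "?Z m" w] by auto
      then show ?case using Suc.IH[of u] by simp
    qed (auto simp: pure_tensor_def split: if_splits)
    moreover have "length (concat (replicate m [(\<one>\<^bsub>G\<^esub>, i), (h, i)])) = 2 * m" for m
      by (induction m) auto
    moreover have "set (concat (replicate m [(\<one>\<^bsub>G\<^esub>, i), (h, i)])) \<subseteq> letters" for m
      using h(1) by (induction m) auto
    ultimately have "\<not> finite_dimensional (class_nichols_algebra G s W \<rho>)"
      using q2 i
      by (intro not_finite_dimensional_class_nichols[of ?Z
          "\<lambda>m. concat (replicate m [(\<one>\<^bsub>G\<^esub>, i), (h, i)])"])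
        (auto simp: x1 y1)
    with fd show False by contradiction
  qed
qed

text \<open>Tensors over the module do not distinguish letters that differ by a central element
  acting trivially on \<open>W\<close>.  The braidings of the classes of $s$ and $zs$ differ by a translation
  of one letter by $z^{-1}$, so the quantum symmetrizers agree on the tensor algebra and the
  two Nichols algebras are equal, not only isomorphic.\<close>

lemma class_nichols_algebra_central_twist:
  assumes z: "z \<in> center G" and triv: "\<And>v. v \<in> W \<Longrightarrow> \<rho> z v = v"
  shows "class_nichols_algebra G (z \<otimes>\<^bsub>G\<^esub> s) W \<rho> = class_nichols_algebra G s W \<rho>"
proof -
  define C where "C = {c \<in> center G. \<forall>v\<in>W. \<rho> c v = v}"
  have central: "c \<in> carrier G" "c \<otimes>\<^bsub>G\<^esub> g = g \<otimes>\<^bsub>G\<^esub> c" if "c \<in> center G" "g \<in> carrier G" for c g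
    using that by (auto simp: center_def)
  have C: "c \<in> center G" "c \<in> K" "c \<in> carrier G" if "c \<in> C" for c
    using that central s by (auto simp: C_def)
  have zC: "z \<in> C" using z triv by (simp add: C_def)
  have zs: "z \<in> carrier G" "z \<otimes>\<^bsub>G\<^esub> s \<in> carrier G" using C(3)[OF zC] s by auto
  have cent: "centralizer G s = G\<lparr>carrier := K\<rparr>" by (simp add: centralizer_def)
  have mult: "\<rho> (g \<otimes>\<^bsub>G\<^esub> k) u = \<rho> g (\<rho> k u)" if "g \<in> K" "k \<in> K" "u \<in> W" for g k u
    using \<rho> that by (auto simp: representation_def cent)
  have \<rho>_one: "\<rho> \<one>\<^bsub>G\<^esub> u = u" if "u \<in> W" for u using \<rho> that by (auto simp: representation_def cent)
  have inv_C: "inv\<^bsub>G\<^esub> c \<in> C" if "c \<in> C" for c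
  proof -
    have i: "inv\<^bsub>G\<^esub> c \<in> K" using subgroup.m_inv_closed[OF subgroup_K C(2)[OF that]] .
    have "\<rho> (inv\<^bsub>G\<^esub> c) v = v" if v: "v \<in> W" for v
    proof -
      have "\<rho> (inv\<^bsub>G\<^esub> c) v = \<rho> (inv\<^bsub>G\<^esub> c) (\<rho> c v)" using \<open>c \<in> C\<close> v by (simp add: C_def)
      also have "\<dots> = \<rho> (inv\<^bsub>G\<^esub> c \<otimes>\<^bsub>G\<^esub> c) v" using mult[OF i C(2)[OF \<open>c \<in> C\<close>] v] by simp
      also have "\<dots> = v" using C(3)[OF \<open>c \<in> C\<close>] \<rho>_one[OF v] by simp
      finally show ?thesis .
    qed
    then show ?thesis using inv_center[OF G C(1)[OF that]] by (simp add: C_def)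
  qed
  have mult_C: "c \<otimes>\<^bsub>G\<^esub> d \<in> C" if "c \<in> C" "d \<in> C" for c d
  proof -
    have cd: "c \<in> carrier G" "d \<in> carrier G" using C(3) that by auto
    have "c \<otimes>\<^bsub>G\<^esub> d \<otimes>\<^bsub>G\<^esub> g = g \<otimes>\<^bsub>G\<^esub> (c \<otimes>\<^bsub>G\<^esub> d)" if g: "g \<in> carrier G" for g
    proof -
      have "c \<otimes>\<^bsub>G\<^esub> d \<otimes>\<^bsub>G\<^esub> g = (c \<otimes>\<^bsub>G\<^esub> g) \<otimes>\<^bsub>G\<^esub> d"
        using cd g by (simp add: m_assoc central(2)[OF C(1)[OF \<open>d \<in> C\<close>] g])
      also have "\<dots> = g \<otimes>\<^bsub>G\<^esub> (c \<otimes>\<^bsub>G\<^esub> d)"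
        unfolding central(2)[OF C(1)[OF \<open>c \<in> C\<close>] g] using cd g by (simp add: m_assoc)
      finally show ?thesis .
    qed
    then have "c \<otimes>\<^bsub>G\<^esub> d \<in> center G" using cd by (simp add: center_def)
    moreover have "\<rho> (c \<otimes>\<^bsub>G\<^esub> d) v = v" if "v \<in> W" for v
      unfolding mult[OF C(2)[OF \<open>c \<in> C\<close>] C(2)[OF \<open>d \<in> C\<close>] that]
      using that \<open>c \<in> C\<close> \<open>d \<in> C\<close> by (simp add: C_def)
    ultimately show ?thesis by (simp add: C_def)
  qed
  have conj_twist: "conj_by G (d \<otimes>\<^bsub>G\<^esub> g) (z \<otimes>\<^bsub>G\<^esub> s) = z \<otimes>\<^bsub>G\<^esub> conj_by G g s"
    if "d \<in> C" and g: "g \<in> carrier G" for d g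
    using conj_by_central_left[OF G C(1)[OF \<open>d \<in> C\<close>] g zs(2)] conj_by_central_mult[OF G z g s] by simp
  \<comment> \<open>letters that no vector of the module separates; the relation has to contain all of \<open>C\<close> because
    the translations by $z^{-1}$ accumulate\<close>
  define E :: "'g \<times> 'i \<Rightarrow> 'g \<times> 'i \<Rightarrow> bool" where
    "E p p' \<longleftrightarrow> p \<in> letters \<and> snd p' = snd p \<and> (\<exists>c\<in>C. fst p' = c \<otimes>\<^bsub>G\<^esub> fst p)" for p p'
  have one_C: "\<one>\<^bsub>G\<^esub> \<in> C" using mult_C[OF inv_C[OF zC] zC] zs(1) by simp
  have E_translate: "E (translate_back G s q p) (translate_back G (z \<otimes>\<^bsub>G\<^esub> s) q' p')"
    if pp: "E p p'" and qq: "E q q'" for p p' q q'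
  proof -
    obtain c d where c: "c \<in> C" "fst p' = c \<otimes>\<^bsub>G\<^esub> fst p" and d: "d \<in> C" "fst q' = d \<otimes>\<^bsub>G\<^esub> fst q"
      using pp qq unfolding E_def by blast
    have pq: "fst p \<in> carrier G" "fst q \<in> carrier G" using pp qq by (auto simp: E_def)
    define g where "g = conj_by G (fst q) s"
    have g: "g \<in> carrier G" using pq s by (simp add: g_def conj_by_def)
    have cc: "c \<in> carrier G" using C(3)[OF c(1)] .
    have "inv\<^bsub>G\<^esub> (z \<otimes>\<^bsub>G\<^esub> g) \<otimes>\<^bsub>G\<^esub> (c \<otimes>\<^bsub>G\<^esub> fst p) = inv\<^bsub>G\<^esub> (g \<otimes>\<^bsub>G\<^esub> z) \<otimes>\<^bsub>G\<^esub> (c \<otimes>\<^bsub>G\<^esub> fst p)"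
      by (simp only: central(2)[OF z g])
    also have "\<dots> = inv\<^bsub>G\<^esub> z \<otimes>\<^bsub>G\<^esub> (inv\<^bsub>G\<^esub> g \<otimes>\<^bsub>G\<^esub> c) \<otimes>\<^bsub>G\<^esub> fst p"
      using g zs(1) cc pq by (simp add: inv_mult_group m_assoc)
    also have "\<dots> = (inv\<^bsub>G\<^esub> z \<otimes>\<^bsub>G\<^esub> c) \<otimes>\<^bsub>G\<^esub> (inv\<^bsub>G\<^esub> g \<otimes>\<^bsub>G\<^esub> fst p)"
      unfolding central(2)[OF C(1)[OF c(1)] inv_closed[OF g], symmetric]
      using g zs(1) cc pq by (simp add: m_assoc)
    finally have "fst (translate_back G (z \<otimes>\<^bsub>G\<^esub> s) q' p') =
        (inv\<^bsub>G\<^esub> z \<otimes>\<^bsub>G\<^esub> c) \<otimes>\<^bsub>G\<^esub> fst (translate_back G s q p)"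
      by (simp add: translate_back_def c(2) d(2) conj_twist[OF d(1) pq(2)] g_def)
    then show ?thesis
      using pp qq mult_C[OF inv_C[OF zC] c(1)] class_braiding_letters(2)[OF G fin s, of p q]
      unfolding E_def by (auto simp: translate_back_def)
  qed
  have E_refl: "E p p" if "p \<in> letters" for p
    using that by (auto simp: E_def intro!: bexI[OF _ one_C])
  let ?M = "class_module G s W \<rho>"
  have invariant: "x p = x p'" if x: "x \<in> ?M" and pp: "E p p'" for x p p'
  proof -
    obtain c where c: "c \<in> C" "fst p' = c \<otimes>\<^bsub>G\<^esub> fst p" using pp unfolding E_def by blast
    have p: "fst p \<in> carrier G" using pp by (auto simp: E_def)
    have "(\<lambda>i. x (fst p \<otimes>\<^bsub>G\<^esub> c, i)) = \<rho> (inv\<^bsub>G\<^esub> c) (\<lambda>i. x (fst p, i))"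
      using x p C(2)[OF c(1)] by (auto simp: class_module_def ind_space_def cent)
    also have "\<dots> = (\<lambda>i. x (fst p, i))"
      using x p inv_C[OF c(1)] by (auto simp: class_module_def ind_space_def C_def)
    finally have "x (fst p \<otimes>\<^bsub>G\<^esub> c, snd p) = x (fst p, snd p)" by (rule fun_cong)
    moreover have "p' = (fst p \<otimes>\<^bsub>G\<^esub> c, snd p)"
      using pp c(2) central(2)[OF C(1)[OF c(1)] p] by (auto simp: E_def prod_eq_iff)
    ultimately show ?thesis by simp
  qed
  have tensor: "(\<forall>u u'. list_all2 E u u' \<longrightarrow> t u = t u') \<and> (\<forall>u. t u \<noteq> 0 \<longrightarrow> set u \<subseteq> letters)"
    if "t \<in> carrier (tensor_algebra ?M)" for t
  proof -
    have "t \<in> cfun.span {pure_tensor xs | xs. set xs \<subseteq> ?M}" using that by (simp add: tensor_algebra_def)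
    then show ?thesis
    proof (induction rule: cfun.span_induct_alt)
      case base
      show ?case by simp
    next
      case (step a x y)
      then obtain xs where x: "x = pure_tensor xs" and xs: "set xs \<subseteq> ?M" by auto
      have "x u = x u'" if "list_all2 E u u'" for u u'
        unfolding x pure_tensor_def list_all2_lengthD[OF that]
        using xs by (auto intro!: prod.cong invariant list_all2_nthD[OF that]
          simp: list_all2_lengthD[OF that])
      moreover have "set u \<subseteq> letters" if "x u \<noteq> 0" for u
      proof (rule ccontr)
        assume "\<not> set u \<subseteq> letters"
        then obtain k where k: "k < length u" "fst (u ! k) \<notin> carrier G"
          by (force simp: in_set_conv_nth subset_iff)
        have "length u = length xs" using that by (auto simp: x pure_tensor_def split: if_splits)
        then have "xs ! k \<in> ?M" using k(1) xs nth_mem[of k xs] by (simp add: subset_iff)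
        then have "(xs ! k) (fst (u ! k), snd (u ! k)) = 0"
          using k(2) unfolding class_module_def ind_space_def by blast
        then have "x u = 0" using k(1) \<open>length u = length xs\<close> by (auto simp: x pure_tensor_def)
        with that show False by contradiction
      qed
      moreover have "cscale a x u = a * x u" for u by (simp add: cscale_def)
      ultimately show ?case using step(2) by (metis add_0 mult_zero_right plus_fun_apply)
    qed
  qed
  have c_supp: "p \<in> letters \<and> t (q, translate_back G s' q p) \<noteq> 0"
    if "class_braiding G s' t (p, q) \<noteq> 0" for s' p q and t :: "('g \<times> 'i) \<times> ('g \<times> 'i) \<Rightarrow> complex"
    using that by (cases p) (auto simp: class_braiding_apply[OF fin] split: if_splits)
  have eq: "quantum_symmetrizer (class_braiding G (z \<otimes>\<^bsub>G\<^esub> s)) k (homogeneous_part k t) =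
      quantum_symmetrizer (class_braiding G s) k (homogeneous_part k t)"
    if t: "t \<in> carrier (tensor_algebra ?M)" for k t
  proof
    fix w
    have supp: "supported_on k letters (quantum_symmetrizer (class_braiding G s') k (homogeneous_part k t))"
      for s'
    proof (rule supported_on_quantum_symmetrizer[where r = "translate_back G s'"])
      show "linear_operator (class_braiding G s')" by (rule linear_operator_class_braiding[OF fin])
      show "supported_on k letters (homogeneous_part k t)"
        using tensor[OF t] by (auto simp: supported_on_def homogeneous_part_def)
    qed (rule c_supp)
    show "quantum_symmetrizer (class_braiding G (z \<otimes>\<^bsub>G\<^esub> s)) k (homogeneous_part k t) w =
      quantum_symmetrizer (class_braiding G s) k (homogeneous_part k t) w"
    proof (cases "length w = k \<and> set w \<subseteq> letters")
      case True
      have "quantum_symmetrizer (class_braiding G (z \<otimes>\<^bsub>G\<^esub> s)) k (homogeneous_part k t) w =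
          symmetrized_value (translate_back G (z \<otimes>\<^bsub>G\<^esub> s)) w (homogeneous_part k t)"
        using True by (intro quantum_symmetrizer_value[OF class_braiding_letters[OF G fin zs(2)]]) auto
      also have "\<dots> = symmetrized_value (translate_back G s) w (homogeneous_part k t)"
      proof (rule sym, rule symmetrized_value_parametric[where E = E])
        show "list_all2 E w w" using True by (auto intro!: list.rel_refl_strong E_refl)
        show "homogeneous_part k t u = homogeneous_part k t u'" if "list_all2 E u u'" for u u'
          using tensor[OF t] that list_all2_lengthD[OF that] by (auto simp: homogeneous_part_def)
      qed (rule E_translate)
      also have "\<dots> = quantum_symmetrizer (class_braiding G s) k (homogeneous_part k t) w"
        using True
        by (intro quantum_symmetrizer_value[OF class_braiding_letters[OF G fin s], symmetric]) auto
      finally show ?thesis .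
    next
      case False
      then show ?thesis using supp unfolding supported_on_def by metis
    qed
  qed
  have "centralizer G (z \<otimes>\<^bsub>G\<^esub> s) = centralizer G s" by (rule centralizer_central_mult[OF G z s])
  then have "class_module G (z \<otimes>\<^bsub>G\<^esub> s) W \<rho> = ?M" by (simp add: class_module_def)
  moreover have "nichols_ideal ?M (class_braiding G (z \<otimes>\<^bsub>G\<^esub> s)) = nichols_ideal ?M (class_braiding G s)"
    by (auto simp: nichols_ideal_def eq)
  ultimately show ?thesis by (simp add: class_nichols_algebra_def nichols_algebra_def)
qed

end

section \<open>Eigenvectors\<close>

lemma linear_map_on_sum:
  assumes T: "linear_map_on V T" and V: "cfun.subspace V" and "\<And>j. j \<in> J \<Longrightarrow> u j \<in> V"
  shows "T (\<Sum>j\<in>J. u j) = (\<Sum>j\<in>J. T (u j))"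
  using assms(3)
proof (induction J rule: infinite_finite_induct)
  case (insert j J)
  have "T (u j + sum u J) = T (u j) + T (sum u J)"
    using T insert.prems cfun.subspace_sum[OF V, of J u] unfolding linear_map_on_def by blast
  also have "T (sum u J) = (\<Sum>j\<in>J. T (u j))" using insert by blast
  finally show ?case unfolding sum.insert[OF insert.hyps] .
next
  have "T (cscale 0 0) = cscale 0 (T 0)"
    using T cfun.subspace_0[OF V] unfolding linear_map_on_def by blast
  then have T0: "T 0 = 0" by (simp add: cscale_def zero_fun_def)
  {
    case empty
    show ?case by (simp only: sum.empty T0)
  next
    case (infinite J)
    then show ?case by (simp only: sum.infinite T0 not_False_eq_True)
  }
qed

lemma roots_of_unity_orthogonality:
  assumes "j < N"
  shows "(\<Sum>k<N. cis (2 * pi / N) ^ (k * j)) = (if j = 0 then of_nat N else 0)"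
proof (cases "j = 0")
  case False
  let ?z = "cis (2 * pi / N) ^ j"
  have N: "0 < N" using assms by simp
  have z: "?z = cis (2 * pi * j / N)" by (simp add: DeMoivre mult_ac)
  have "inj_on (\<lambda>k. cis (2 * pi * real k / real N)) {..<N}"
    using bij_betw_roots_unity[OF N] by (rule bij_betw_imp_inj_on)
  then have "?z \<noteq> 1"
    using inj_onD[of _ "{..<N}" j 0] assms N False z by fastforce
  moreover have "?z ^ N = 1"
    using N cis_multiple_2pi[of "real j"] by (simp add: z DeMoivre mult.commute)
  ultimately have "(\<Sum>k<N. ?z ^ k) = 0" by (simp add: geometric_sum)
  then show ?thesis using False by (simp add: power_mult[symmetric] mult.commute)
qed simp

text \<open>The Fourier components $v_k = \sum_j \zeta^{kj} T^j w$ of a nonzero vector are eigenvectors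
  of $T$ or zero, and they sum to $N w \neq 0$.\<close>

lemma eigenvector_of_finite_order:
  assumes V: "cfun.subspace V" and T: "linear_map_on V T" "T ` V \<subseteq> V"
    and w: "w \<in> V" "w \<noteq> 0" and N: "N > 0" "(T ^^ N) w = w"
  obtains v q where "v \<in> V" "v \<noteq> 0" "T v = cscale q v"
proof -
  define \<zeta> where "\<zeta> = cis (2 * pi / N)"
  have \<zeta>N: "\<zeta> ^ N = 1" using N by (simp add: \<zeta>_def DeMoivre)
  have Tw: "(T ^^ j) w \<in> V" for j using w(1) T(2) by (induction j) auto
  define v where "v k = (\<Sum>j<N. cscale (\<zeta> ^ (k * j)) ((T ^^ j) w))" for k
  have vV: "v k \<in> V" for k
    unfolding v_def by (intro cfun.subspace_sum[OF V] cfun.subspace_scale[OF V] Tw)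
  have Tv: "cscale (\<zeta> ^ k) (T (v k)) = v k" for k
  proof -
    define e where "e j = cscale (\<zeta> ^ (k * j)) ((T ^^ j) w)" for j
    have "T (v k) = (\<Sum>j<N. cscale (\<zeta> ^ (k * j)) ((T ^^ Suc j) w))"
      unfolding v_def
      by (subst linear_map_on_sum[OF T(1) V])
        (use T(1) Tw in \<open>auto simp: linear_map_on_def cfun.subspace_scale[OF V]\<close>)
    then have "cscale (\<zeta> ^ k) (T (v k)) = (\<Sum>j<N. e (Suc j))"
      by (simp add: e_def cfun.scale_sum_right power_add)
    also have "\<dots> = (\<Sum>j<N. e j) + e N - e 0"
      by (simp add: sum.lessThan_Suc_shift[symmetric] sum.lessThan_Suc[symmetric]
        del: sum.lessThan_Suc)
        (metis add_diff_cancel_left' sum.lessThan_Suc sum.lessThan_Suc_shift)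
    also have "e N = e 0"
      using \<zeta>N N(2) by (simp add: e_def mult.commute[of k] power_mult)
    finally show ?thesis by (simp add: v_def e_def)
  qed
  have "\<exists>k<N. v k \<noteq> 0"
  proof (rule ccontr)
    assume "\<not> (\<exists>k<N. v k \<noteq> 0)"
    then have "0 = (\<Sum>k<N. v k)" by simp
    also have "\<dots> = (\<Sum>j<N. cscale (\<Sum>k<N. \<zeta> ^ (k * j)) ((T ^^ j) w))"
      unfolding v_def by (subst sum.swap) (simp add: cfun.scale_sum_left)
    also have "\<dots> = (\<Sum>j<N. if j = 0 then cscale (of_nat N) w else 0)"
      by (intro sum.cong refl) (auto simp: \<zeta>_def roots_of_unity_orthogonality)
    also have "\<dots> = cscale (of_nat N) w" using N(1) by (simp add: sum.delta')
    finally show False using w(2) N(1) by (simp add: fun_eq_iff cscale_def)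
  qed
  then obtain k where k: "v k \<noteq> 0" by blast
  have "T (v k) = cscale (inverse (\<zeta> ^ k)) (cscale (\<zeta> ^ k) (T (v k)))"
  proof -
    have "\<zeta> ^ k \<noteq> 0" by (simp add: \<zeta>_def)
    then show ?thesis by (simp only: cfun.scale_scale left_inverse cfun.scale_one not_False_eq_True)
  qed
  then have "T (v k) = cscale (inverse (\<zeta> ^ k)) (v k)" by (simp only: Tv)
  with vV k that show thesis by blast
qed

lemma representation_eigenvector:
  assumes G: "group G" and fin: "finite (carrier G)" and s: "s \<in> carrier G"
    and \<rho>: "representation (centralizer G s) W \<rho>" and W: "W \<noteq> {0}"
  obtains v q where "v \<in> W" "v \<noteq> 0" "\<rho> s v = cscale q v"
proof -
  interpret group G by (fact G)
  have sC: "s \<in> carrier (centralizer G s)" using s by (simp add: centralizer_def)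
  have sub: "cfun.subspace W" and lin: "linear_map_on W (\<rho> s)" "\<rho> s ` W \<subseteq> W"
    using \<rho> sC by (auto simp: representation_def)
  obtain w where w: "w \<in> W" "w \<noteq> 0" using W cfun.subspace_0[OF sub] by blast
  have comm: "s [^]\<^bsub>G\<^esub> j \<otimes>\<^bsub>G\<^esub> s = s \<otimes>\<^bsub>G\<^esub> s [^]\<^bsub>G\<^esub> j" for j :: nat
    using s by (induction j) (simp_all add: m_assoc)
  have "(\<rho> s ^^ j) w = \<rho> (s [^]\<^bsub>G\<^esub> j) w" for j :: nat
  proof (induction j)
    case 0
    then show ?case using \<rho> w(1) by (simp add: representation_def centralizer_def)
  next
    case (Suc j)
    have "s [^]\<^bsub>G\<^esub> j \<in> carrier (centralizer G s)" using s comm by (simp add: centralizer_def)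
    then have "\<rho> (s \<otimes>\<^bsub>centralizer G s\<^esub> s [^]\<^bsub>G\<^esub> j) w = \<rho> s (\<rho> (s [^]\<^bsub>G\<^esub> j) w)"
      using \<rho> w(1) sC unfolding representation_def by blast
    then show ?case using Suc comm by (simp add: centralizer_def)
  qed
  moreover have "\<rho> \<one>\<^bsub>G\<^esub> w = w" using \<rho> w(1) by (simp add: representation_def centralizer_def)
  ultimately have "(\<rho> s ^^ order G) w = w" using pow_order_eq_1[OF s] by simp
  moreover have "order G > 0" using fin by (simp add: order_gt_0_iff_finite)
  ultimately show thesis using eigenvector_of_finite_order[OF sub lin w] that by blast
qed

text \<open>If $s$ is conjugate to its inverse, so is $zs$ for a central involution $z$.  The eigenvalues of
  $s$ and $zs$ on a common eigenvector are opposite, so they cannot both be $-1$.\<close>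

lemma not_both_finite_dimensional:
  assumes G: "group G" and fin: "finite (carrier G)" and s: "s \<in> carrier G"
    and \<rho>: "representation (centralizer G s) W \<rho>" and W: "W \<noteq> {0}"
    and h: "h \<in> carrier G" "conj_by G h s = inv\<^bsub>G\<^esub> s"
    and z: "z \<in> center G" "z \<otimes>\<^bsub>G\<^esub> z = \<one>\<^bsub>G\<^esub>" and neg: "\<And>v. v \<in> W \<Longrightarrow> \<rho> z v = cscale (- 1) v"
  shows "\<not> (finite_dimensional (class_nichols_algebra G (z \<otimes>\<^bsub>G\<^esub> s) W \<rho>) \<and>
    finite_dimensional (class_nichols_algebra G s W \<rho>))"
proof
  interpret group G by (fact G)
  assume fd: "finite_dimensional (class_nichols_algebra G (z \<otimes>\<^bsub>G\<^esub> s) W \<rho>) \<and>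
    finite_dimensional (class_nichols_algebra G s W \<rho>)"
  note zc = center_carrier[OF z(1)]
  obtain v q where v: "v \<in> W" "v \<noteq> 0" "\<rho> s v = cscale q v"
    using representation_eigenvector[OF G fin s \<rho> W] .
  have q: "q = - 1"
    using eigenvalue_minus_one_of_finite_dimensional[OF G fin s \<rho> v h] fd by blast
  have zs: "z \<otimes>\<^bsub>G\<^esub> s \<in> carrier G" using zc s by simp
  have \<rho>': "representation (centralizer G (z \<otimes>\<^bsub>G\<^esub> s)) W \<rho>"
    using \<rho> centralizer_central_mult[OF G z(1) s] by simp
  have "z \<in> carrier (centralizer G s)" "s \<in> carrier (centralizer G s)"
    using zc s center_commute[OF z(1) s] by (auto simp: centralizer_def)
  then have "\<rho> (z \<otimes>\<^bsub>centralizer G s\<^esub> s) v = \<rho> z (\<rho> s v)" and "\<rho> s v \<in> W"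
    using \<rho> v(1) unfolding representation_def by blast+
  then have \<rho>v: "\<rho> (z \<otimes>\<^bsub>G\<^esub> s) v = cscale (- q) v"
    using neg[of "\<rho> s v"] v(3) by (simp add: centralizer_def)
  have "inv\<^bsub>G\<^esub> z = z" using zc z(2) by (simp add: inv_equality)
  then have "inv\<^bsub>G\<^esub> (z \<otimes>\<^bsub>G\<^esub> s) = z \<otimes>\<^bsub>G\<^esub> inv\<^bsub>G\<^esub> s"
    using zc s center_commute[OF z(1), of "inv\<^bsub>G\<^esub> s"] by (simp add: inv_mult_group)
  then have "conj_by G h (z \<otimes>\<^bsub>G\<^esub> s) = inv\<^bsub>G\<^esub> (z \<otimes>\<^bsub>G\<^esub> s)"
    using conj_by_central_mult[OF G z(1) h(1) s] h(2) by simp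
  then have "- q = - 1"
    using eigenvalue_minus_one_of_finite_dimensional[OF G fin zs \<rho>' v(1,2) \<rho>v h(1)] fd by blast
  with q show False by simp
qed

section \<open>Permutations and their inverses\<close>

text \<open>Choose a point $r$ in each orbit of $p$.  The reflection $p^i r \mapsto p^{-i} r$ is an
  involution $h$ with $h p h = p^{-1}$.\<close>

lemma permutation_conjugate_to_inverse:
  assumes p: "p permutes S"
  obtains h where "h permutes S" "h \<circ> p = inv' p \<circ> h"
proof -
  have bp: "bij p" using p by (rule permutes_bij)
  have inj: "(p ^^ k) x = (p ^^ k) y \<longleftrightarrow> x = y" for k x y
    using bp by (simp add: bij_is_inj inj_fn inj_eq)
  have surj: "\<exists>y. (p ^^ k) y = x" for k x
    using bp by (metis bij_is_surj surj_fn surjD)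
  have comm: "(p ^^ k) ((p ^^ j) x) = (p ^^ j) ((p ^^ k) x)" for k j x
    by (metis add.commute comp_apply funpow_add)
  define orbit where "orbit x y \<longleftrightarrow> (\<exists>k j. (p ^^ k) x = (p ^^ j) y)" for x y
  have orbit_sym: "orbit x y \<Longrightarrow> orbit y x" for x y unfolding orbit_def by metis
  have orbit_trans: "orbit x z" if xy: "orbit x y" and yz: "orbit y z" for x y z
  proof -
    obtain k j l m where "(p ^^ k) x = (p ^^ j) y" "(p ^^ l) y = (p ^^ m) z"
      using xy yz unfolding orbit_def by blast
    then have "(p ^^ (l + k)) x = (p ^^ (j + m)) z" by (simp add: funpow_add comm)
    then show ?thesis unfolding orbit_def by blast
  qed
  have orbit_refl: "orbit x x" for x unfolding orbit_def by blast
  define rep where "rep x = (SOME y. orbit x y)" for x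
  have rep: "orbit x (rep x)" for x unfolding rep_def by (rule someI, rule orbit_refl)
  have rep_eq: "rep x = rep y" if "orbit x y" for x y
  proof -
    have "orbit x = orbit y" using that orbit_sym orbit_trans by (intro ext) blast
    then show ?thesis by (simp add: rep_def)
  qed
  \<comment> \<open>the reflection as a relation, with $i = j - k$: only natural powers are used, and the
    two equations are exchanged by swapping both $k, j$ and $x, y$, which makes the relation symmetric\<close>
  define refl where "refl x y \<longleftrightarrow>
    (\<exists>k j. (p ^^ k) x = (p ^^ j) (rep x) \<and> (p ^^ j) y = (p ^^ k) (rep x))" for x y
  have ex: "\<exists>y. refl x y" for x
    using rep[of x] surj unfolding orbit_def refl_def by metis
  have unique: "y = z" if y: "refl x y" and z: "refl x z" for x y z
  proof -
    obtain k j where 1: "(p ^^ k) x = (p ^^ j) (rep x)" "(p ^^ j) y = (p ^^ k) (rep x)"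
      using y unfolding refl_def by blast
    obtain l m where 2: "(p ^^ l) x = (p ^^ m) (rep x)" "(p ^^ m) z = (p ^^ l) (rep x)"
      using z unfolding refl_def by blast
    have e: "(p ^^ l) ((p ^^ j) (rep x)) = (p ^^ k) ((p ^^ m) (rep x))"
      unfolding 1(1)[symmetric] 2(1)[symmetric] by (rule comm)
    have "(p ^^ m) ((p ^^ j) y) = (p ^^ k) ((p ^^ m) (rep x))" unfolding 1(2) by (rule comm)
    also have "\<dots> = (p ^^ j) ((p ^^ m) z)" unfolding 2(2) e[symmetric] by (rule comm)
    also have "\<dots> = (p ^^ m) ((p ^^ j) z)" by (rule comm)
    finally show ?thesis by (simp add: inj)
  qed
  define h where "h x = (THE y. refl x y)" for x
  have h: "refl x (h x)" for x unfolding h_def using ex unique by (metis theI)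
  have h_eq: "h x = y" if "refl x y" for x y using unique[OF h that] .
  have hh: "h (h x) = x" for x
  proof (rule h_eq)
    obtain k j where kj: "(p ^^ k) x = (p ^^ j) (rep x)" "(p ^^ j) (h x) = (p ^^ k) (rep x)"
      using h[of x] unfolding refl_def by blast
    have "orbit (h x) (rep x)" using kj(2) unfolding orbit_def by blast
    then have "rep (h x) = rep x" using rep_eq orbit_trans orbit_sym rep by metis
    then show "refl (h x) x" unfolding refl_def using kj by metis
  qed
  have php: "p (h (p x)) = h x" for x
  proof -
    obtain k j where kj: "(p ^^ k) x = (p ^^ j) (rep x)" "(p ^^ j) (h x) = (p ^^ k) (rep x)"
      using h[of x] unfolding refl_def by blast
    obtain y where y: "p y = h x" using bp by (metis bij_pointE)
    have "orbit (p x) x" unfolding orbit_def by (rule exI[of _ 0], rule exI[of _ 1]) simp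
    then have r: "rep (p x) = rep x" by (rule rep_eq)
    have "(p ^^ k) (p x) = (p ^^ Suc j) (rep x)" using kj(1) by (metis comp_apply funpow.simps(2) funpow_swap1)
    moreover have "(p ^^ Suc j) y = (p ^^ k) (rep x)"
      using kj(2) y by (simp add: funpow_swap1)
    ultimately have "refl (p x) y" unfolding refl_def r by blast
    then show ?thesis using h_eq y by simp
  qed
  show thesis
  proof (rule that)
    have "h x = x" if "x \<notin> S" for x
    proof (rule h_eq)
      have "p x = x" using p that by (rule permutes_not_in)
      then have fix_x: "(p ^^ k) x = x" for k by (induction k) auto
      obtain k j where "(p ^^ k) x = (p ^^ j) (rep x)" using rep[of x] unfolding orbit_def by blast
      then have "(p ^^ j) (rep x) = (p ^^ j) x" by (simp add: fix_x)
      then have "rep x = x" by (simp add: inj)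
      then show "refl x x" unfolding refl_def by metis
    qed
    moreover have "bij h" using hh by (metis bijI' )
    ultimately show "h permutes S" by (simp add: permutes_def bij_iff)
    show "h \<circ> p = inv' p \<circ> h"
      using php bp by (metis bij_inv_eq_iff comp_apply ext)
  qed
qed

section \<open>The semidirect product\<close>

lemma perm_act_id: "perm_act id a = a"
  by (simp add: perm_act_def)

lemma perm_act_comp: "bij s \<Longrightarrow> bij t \<Longrightarrow> perm_act (s \<circ> t) a = perm_act s (perm_act t a)"
  by (simp add: perm_act_def o_inv_distrib)

lemma perm_act_add: "perm_act s (a + b) = perm_act s a + perm_act s b"
  by (auto simp: perm_act_def)

lemma bit_vector_add_self: "a + a = (0 :: nat \<Rightarrow> bit)"
  by (simp add: fun_eq_iff)

lemma perm_act_all_ones: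
  assumes "s permutes {1..n}"
  shows "perm_act s (all_ones n) = all_ones n"
  using permutes_in_image[OF permutes_inv[OF assms]] by (auto simp: perm_act_def all_ones_def fun_eq_iff)

context
  fixes n :: nat and A :: "(nat \<Rightarrow> bit) set" and \<tau> :: "nat \<Rightarrow> nat"
    and G :: "((nat \<Rightarrow> bit) \<times> (nat \<Rightarrow> nat)) monoid"
  assumes A: "subgroup A (bit_vectors n)" and stable: "perm_stable n A"
    and G_def: "G = semidirect A (carrier (sym_group n))"
    and \<tau>: "\<tau> \<in> carrier (sym_group n)"
begin

lemma subgroup_zero: "0 \<in> A" and subgroup_add: "a \<in> A \<Longrightarrow> b \<in> A \<Longrightarrow> a + b \<in> A"
  using subgroup.one_closed[OF A] subgroup.m_closed[OF A] by (auto simp: bit_vectors_def)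

lemma semidirect_carrier_iff: "(a, s) \<in> carrier G \<longleftrightarrow> a \<in> A \<and> s permutes {1..n}"
  and semidirect_mult: "(a, s) \<otimes>\<^bsub>G\<^esub> (b, t) = (a + perm_act s b, s \<circ> t)"
  and semidirect_one: "\<one>\<^bsub>G\<^esub> = (0, id)"
  by (auto simp: G_def semidirect_def sym_group_carrier)

lemma perm_act_closed: "s permutes {1..n} \<Longrightarrow> a \<in> A \<Longrightarrow> perm_act s a \<in> A"
  using stable by (simp add: perm_stable_def sym_group_carrier)

lemma group_semidirect: "group G"
proof (rule groupI)
  fix x y assume "x \<in> carrier G" "y \<in> carrier G"
  moreover obtain a s b t where "x = (a, s)" "y = (b, t)" by (cases x; cases y)
  ultimately show "x \<otimes>\<^bsub>G\<^esub> y \<in> carrier G"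
    unfolding semidirect_carrier_iff semidirect_mult by (simp only: semidirect_carrier_iff semidirect_mult subgroup_add perm_act_closed permutes_compose)
next
  fix x y z assume "x \<in> carrier G" "y \<in> carrier G" "z \<in> carrier G"
  moreover obtain a s b t c u where xyz: "x = (a, s)" "y = (b, t)" "z = (c, u)"
    by (cases x; cases y; cases z)
  ultimately have "bij s" "bij t" by (auto simp: semidirect_carrier_iff intro: permutes_bij)
  then show "x \<otimes>\<^bsub>G\<^esub> y \<otimes>\<^bsub>G\<^esub> z = x \<otimes>\<^bsub>G\<^esub> (y \<otimes>\<^bsub>G\<^esub> z)"
    by (simp add: xyz semidirect_mult perm_act_add perm_act_comp comp_assoc add.assoc)
next
  fix x assume x: "x \<in> carrier G"
  obtain a s where as: "x = (a, s)" by (cases x)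
  have "(perm_act (inv' s) a, inv' s) \<in> carrier G"
    using x by (auto simp: as semidirect_carrier_iff perm_act_closed permutes_inv)
  moreover have "(perm_act (inv' s) a, inv' s) \<otimes>\<^bsub>G\<^esub> x = \<one>\<^bsub>G\<^esub>"
    using x permutes_inv_o(2)[of s "{1..n}"]
    by (simp add: as semidirect_mult semidirect_one semidirect_carrier_iff bit_vector_add_self)
  ultimately show "\<exists>y\<in>carrier G. y \<otimes>\<^bsub>G\<^esub> x = \<one>\<^bsub>G\<^esub>" by blast
qed (auto simp: semidirect_one semidirect_mult semidirect_carrier_iff subgroup_zero permutes_id perm_act_id)

lemma finite_semidirect: "finite (carrier G)"
proof -
  have "A \<subseteq> {f. \<forall>x. (x \<in> {1..n} \<longrightarrow> f x \<in> {0, 1}) \<and> (x \<notin> {1..n} \<longrightarrow> f x = 0)}"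
    using subgroup.subset[OF A] by (auto simp: bit_vectors_def)
  then have "finite A"
    by (rule finite_subset) (rule finite_set_of_finite_funs, auto)
  then show ?thesis
    by (simp add: G_def semidirect_def sym_group_def finite_permutations)
qed

lemma all_ones_central:
  assumes "all_ones n \<in> A"
  shows "(all_ones n, id) \<in> center G"
  using assms by (auto simp: center_def semidirect_carrier_iff semidirect_mult permutes_id perm_act_id perm_act_all_ones add.commute)

lemma all_ones_mult: "(all_ones n, id) \<otimes>\<^bsub>G\<^esub> (0, s) = (all_ones n, s)"
  by (simp add: semidirect_mult perm_act_id)

lemma centralizer_permutation:
  "centralizer G (0, \<tau>) = semidirect (fixed_vectors A \<tau>) (carrier (centralizer (sym_group n) \<tau>))"
proof -
  have "perm_act s 0 = 0" for s by (simp add: perm_act_def fun_eq_iff)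
  then have "{g \<in> carrier G. g \<otimes>\<^bsub>G\<^esub> (0, \<tau>) = (0, \<tau>) \<otimes>\<^bsub>G\<^esub> g} =
      fixed_vectors A \<tau> \<times> carrier (centralizer (sym_group n) \<tau>)"
    by (auto simp: semidirect_carrier_iff semidirect_mult fixed_vectors_def centralizer_def sym_group_carrier sym_group_mult)
  then have "centralizer G (0, \<tau>) =
      G\<lparr>carrier := fixed_vectors A \<tau> \<times> carrier (centralizer (sym_group n) \<tau>)\<rparr>"
    by (simp only: centralizer_def[of G])
  also have "\<dots> = semidirect (fixed_vectors A \<tau>) (carrier (centralizer (sym_group n) \<tau>))"
    by (simp add: semidirect_def G_def)
  finally show ?thesis .
qed

text \<open>The element $\alpha$ is central and belongs to the subgroup from which $\theta_{\chi,\mu}$ is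
  induced, where it acts by $\chi(\alpha)$; so it acts by this scalar on the induced module.\<close>

lemma theta_space_all_ones:
  fixes V :: "('v \<Rightarrow> complex) set"
  assumes \<alpha>: "all_ones n \<in> A" and \<mu>: "representation (char_stabilizer n A \<tau> \<chi>) V \<mu>"
    and f: "f \<in> theta_space n A \<tau> \<chi> V \<mu>"
  shows "ind_act (centralizer G (0, \<tau>)) (all_ones n, id) f = cscale (\<chi> (all_ones n)) f"
proof -
  let ?C = "centralizer G (0, \<tau>)" and ?a = "(all_ones n, id) :: (nat \<Rightarrow> bit) \<times> (nat \<Rightarrow> nat)"
  let ?K = "semidirect (fixed_vectors A \<tau>) (carrier (char_stabilizer n A \<tau> \<chi>))"
  have \<tau>p: "\<tau> permutes {1..n}" using \<tau> by (simp add: sym_group_carrier)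
  interpret group G by (rule group_semidirect)
  have s: "(0, \<tau>) \<in> carrier G" using \<tau>p subgroup_zero by (simp add: semidirect_carrier_iff)
  have cent: "?C = G\<lparr>carrier := {g \<in> carrier G. g \<otimes>\<^bsub>G\<^esub> (0, \<tau>) = (0, \<tau>) \<otimes>\<^bsub>G\<^esub> g}\<rparr>"
    by (simp add: centralizer_def)
  have sub: "subgroup {g \<in> carrier G. g \<otimes>\<^bsub>G\<^esub> (0, \<tau>) = (0, \<tau>) \<otimes>\<^bsub>G\<^esub> g} G"
    by (rule centralizer_subgroup[OF is_group s])
  interpret C: group ?C unfolding cent by (rule subgroup.subgroup_is_group[OF sub is_group])
  have aG: "?a \<in> center G" by (rule all_ones_central[OF \<alpha>])
  have aC: "?a \<in> carrier ?C"
    using center_carrier[OF aG] center_commute[OF aG s] by (simp add: centralizer_def)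
  have aa: "?a \<otimes>\<^bsub>?C\<^esub> ?a = \<one>\<^bsub>?C\<^esub>"
    by (simp add: cent semidirect_mult semidirect_one perm_act_id bit_vector_add_self)
  have inv_a: "inv\<^bsub>?C\<^esub> ?a = ?a" by (rule C.inv_equality[OF aa aC aC])
  have "id \<in> carrier (char_stabilizer n A \<tau> \<chi>)"
    by (simp add: char_stabilizer_def centralizer_def sym_group_carrier permutes_id sym_group_mult
      perm_act_id)
  then have aK: "?a \<in> carrier ?K"
    using \<alpha> perm_act_all_ones[OF \<tau>p] by (simp add: semidirect_def fixed_vectors_def)
  have one_\<mu>: "\<mu> id v = v" if "v \<in> V" for v
    using \<mu> that by (simp add: representation_def char_stabilizer_def sym_group_one)
  have f': "f \<in> ind_space ?C ?K V (char_tensor \<chi> \<mu>)" using f by (simp add: theta_space_def G_def)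
  show ?thesis
  proof (rule ext)
    fix p :: "((nat \<Rightarrow> bit) \<times> (nat \<Rightarrow> nat)) \<times> 'v"
    obtain g i where p: "p = (g, i)" by (cases p)
    show "ind_act ?C ?a f p = cscale (\<chi> (all_ones n)) f p"
    proof (cases "g \<in> carrier ?C")
      case True
      have "g \<in> carrier G" using True by (simp add: centralizer_def)
      then have "?a \<otimes>\<^bsub>?C\<^esub> g = g \<otimes>\<^bsub>?C\<^esub> ?a" using center_commute[OF aG] by (simp add: cent)
      moreover have "(\<lambda>i. f (g \<otimes>\<^bsub>?C\<^esub> ?a, i)) = char_tensor \<chi> \<mu> (inv\<^bsub>?C\<^esub> ?a) (\<lambda>i. f (g, i))"
        using f' True aK unfolding ind_space_def by blast
      moreover have "(\<lambda>i. f (g, i)) \<in> V" using f' True unfolding ind_space_def by blast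
      ultimately show ?thesis
        using True by (simp add: ind_act_def p inv_a char_tensor_def one_\<mu> cscale_def fun_eq_iff)
    next
      case False
      then have "f (g, i) = 0" using f' unfolding ind_space_def by blast
      then show ?thesis using False by (simp add: ind_act_def p cscale_def)
    qed
  qed
qed

text \<open>Scalar actions are transported along isomorphisms of representations.\<close>

lemma all_ones_acts_by_character:
  assumes \<alpha>: "all_ones n \<in> A" and \<mu>: "representation (char_stabilizer n A \<tau> \<chi>) V \<mu>"
    and \<rho>: "representation (centralizer G (0, \<tau>)) W \<rho>"
    and iso: "rep_iso (centralizer G (0, \<tau>)) W \<rho> (theta_space n A \<tau> \<chi> V \<mu>) (ind_act (centralizer G (0, \<tau>)))"
    and w: "w \<in> W"
  shows "\<rho> (all_ones n, id) w = cscale (\<chi> (all_ones n)) w"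
proof -
  let ?C = "centralizer G (0, \<tau>)" and ?a = "(all_ones n, id) :: (nat \<Rightarrow> bit) \<times> (nat \<Rightarrow> nat)"
  have "(0, \<tau>) \<in> carrier G" using \<tau> subgroup_zero by (simp add: semidirect_carrier_iff sym_group_carrier)
  then have aC: "?a \<in> carrier ?C"
    using center_carrier[OF all_ones_central[OF \<alpha>]] center_commute[OF all_ones_central[OF \<alpha>]]
    by (simp add: centralizer_def)
  obtain T where T: "linear_map_on W T" "bij_betw T W (theta_space n A \<tau> \<chi> V \<mu>)"
    and eqv: "\<And>v. v \<in> W \<Longrightarrow> T (\<rho> ?a v) = ind_act ?C ?a (T v)"
    using iso aC unfolding rep_iso_def by blast
  have "T w \<in> theta_space n A \<tau> \<chi> V \<mu>" using T(2) w by (rule bij_betw_apply)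
  then have "T (\<rho> ?a w) = cscale (\<chi> (all_ones n)) (T w)"
    using eqv[OF w] theta_space_all_ones[OF \<alpha> \<mu>] by simp
  also have "\<dots> = T (cscale (\<chi> (all_ones n)) w)" using T(1) w by (simp add: linear_map_on_def)
  finally have "T (\<rho> ?a w) = T (cscale (\<chi> (all_ones n)) w)" .
  moreover have "\<rho> ?a w \<in> W" using \<rho> aC w unfolding representation_def by blast
  moreover have "cscale (\<chi> (all_ones n)) w \<in> W"
    using \<rho> w cfun.subspace_scale unfolding representation_def by blast
  ultimately show ?thesis using bij_betw_imp_inj_on[OF T(2)] by (blast dest: inj_onD)
qed

text \<open>The conjugating permutation exists in $\mathbb S_n$; it stays a conjugating element
  in $G$ since $\mathbb S_n$ is a subgroup.\<close>

lemma permutation_real: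
  obtains h where "h \<in> carrier G" "conj_by G h (0, \<tau>) = inv\<^bsub>G\<^esub> (0, \<tau>)"
proof -
  interpret group G by (rule group_semidirect)
  have \<tau>p: "\<tau> permutes {1..n}" using \<tau> by (simp add: sym_group_carrier)
  have act0: "perm_act s 0 = 0" for s by (simp add: perm_act_def fun_eq_iff)
  obtain h where h: "h permutes {1..n}" "h \<circ> \<tau> = inv' \<tau> \<circ> h"
    using permutation_conjugate_to_inverse[OF \<tau>p] .
  have mem: "(0, \<tau>) \<in> carrier G" "(0, inv' \<tau>) \<in> carrier G" "(0, h) \<in> carrier G"
    using \<tau>p h(1) subgroup_zero by (auto simp: semidirect_carrier_iff permutes_inv)
  have "inv' \<tau> \<circ> \<tau> = id" using permutes_inv_o(2)[OF \<tau>p] .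
  then have "(0, inv' \<tau>) \<otimes>\<^bsub>G\<^esub> (0, \<tau>) = \<one>\<^bsub>G\<^esub>" by (simp add: semidirect_mult semidirect_one act0)
  then have inv_\<tau>: "inv\<^bsub>G\<^esub> (0, \<tau>) = (0, inv' \<tau>)" by (rule inv_equality[OF _ mem(1,2)])
  have "(0, h) \<otimes>\<^bsub>G\<^esub> (0, \<tau>) = (0, inv' \<tau>) \<otimes>\<^bsub>G\<^esub> (0, h)" by (simp add: semidirect_mult act0 h(2))
  then have "conj_by G (0, h) (0, \<tau>) = (0, inv' \<tau>)" using mem by (simp add: conj_by_def m_assoc)
  then show thesis using that[of "(0, h)"] mem(3) inv_\<tau> by simp
qed

end

section \<open>The proposition\<close>

theorem proposition2p9:
  fixes n :: nat
    and A :: "(nat \<Rightarrow> bit) set"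
    and \<tau> :: "nat \<Rightarrow> nat"
    and \<alpha> :: "nat \<Rightarrow> bit"
    and G :: "((nat \<Rightarrow> bit) \<times> (nat \<Rightarrow> nat)) monoid"
    and \<sigma> :: "(nat \<Rightarrow> bit) \<times> (nat \<Rightarrow> nat)"
  assumes "subgroup A (bit_vectors n)"
    and "perm_stable n A"
    and "\<alpha> = all_ones n"
    and "\<alpha> \<in> A"
    and "G = semidirect A (carrier (sym_group n))"
    and "\<tau> \<in> carrier (sym_group n)"
    and "\<sigma> = (\<alpha>, \<tau>)"
  shows "centralizer G \<sigma> = centralizer G (0, \<tau>) \<and>
    centralizer G (0, \<tau>) =
      semidirect (fixed_vectors A \<tau>) (carrier (centralizer (sym_group n) \<tau>)) \<and>
    conj_class G (\<alpha>, \<tau>) = (\<alpha>, id) <#\<^bsub>G\<^esub> conj_class G (0, \<tau>) \<and>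
    (\<forall>(H :: 'h monoid) \<sigma>' a.
      group H \<longrightarrow> finite (carrier H) \<longrightarrow> \<sigma>' \<in> carrier H \<longrightarrow> a \<in> center H \<longrightarrow>
      (rack_type_D (conj_class H \<sigma>') (conj_by H) \<longleftrightarrow>
       rack_type_D (a <#\<^bsub>H\<^esub> conj_class H \<sigma>') (conj_by H))) \<and>
    (\<forall>(\<chi> :: (nat \<Rightarrow> bit) \<Rightarrow> complex)
      (V :: ('i \<Rightarrow> complex) set) (\<mu> :: (nat \<Rightarrow> nat) \<Rightarrow> ('i \<Rightarrow> complex) \<Rightarrow> ('i \<Rightarrow> complex))
      (W :: ('j \<Rightarrow> complex) set)
      (\<rho> :: (nat \<Rightarrow> bit) \<times> (nat \<Rightarrow> nat) \<Rightarrow> ('j \<Rightarrow> complex) \<Rightarrow> ('j \<Rightarrow> complex)).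
      linear_character ((bit_vectors n)\<lparr>carrier := fixed_vectors A \<tau>\<rparr>) \<chi> \<longrightarrow>
      irreducible_rep (char_stabilizer n A \<tau> \<chi>) V \<mu> \<longrightarrow>
      irreducible_rep (centralizer G \<sigma>) W \<rho> \<longrightarrow>
      rep_iso (centralizer G \<sigma>) W \<rho>
        (theta_space n A \<tau> \<chi> V \<mu>) (ind_act (centralizer G (0, \<tau>))) \<longrightarrow>
      (\<chi> \<alpha> = 1 \<longrightarrow>
        (finite_dimensional (class_nichols_algebra G (\<alpha>, \<tau>) W \<rho>) \<longleftrightarrow>
         finite_dimensional (class_nichols_algebra G (0, \<tau>) W \<rho>))) \<and>
      (\<chi> \<alpha> = -1 \<longrightarrow>
        \<not> (finite_dimensional (class_nichols_algebra G (\<alpha>, \<tau>) W \<rho>) \<and>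
           finite_dimensional (class_nichols_algebra G (0, \<tau>) W \<rho>))))"
proof -
  have Gg: "group G" by (rule group_semidirect[OF assms(1,2,5,6)])
  have Gf: "finite (carrier G)" by (rule finite_semidirect[OF assms(1,2,5,6)])
  let ?z = "(\<alpha>, id) :: (nat \<Rightarrow> bit) \<times> (nat \<Rightarrow> nat)"
  have \<alpha>: "all_ones n \<in> A" using assms(3,4) by simp
  have z: "?z \<in> center G" using all_ones_central[OF assms(1,2,5,6) \<alpha>] assms(3) by simp
  have zs: "(\<alpha>, \<tau>) = ?z \<otimes>\<^bsub>G\<^esub> (0, \<tau>)"
    using all_ones_mult[OF assms(1,2,5,6), of \<tau>] assms(3) by simp
  have zz: "?z \<otimes>\<^bsub>G\<^esub> ?z = \<one>\<^bsub>G\<^esub>"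
    by (simp add: semidirect_mult[OF assms(1,2,5,6)] semidirect_one[OF assms(1,2,5,6)] perm_act_id bit_vector_add_self)
  have s: "(0, \<tau>) \<in> carrier G"
    using assms(6) subgroup_zero[OF assms(1,2,5,6)]
    by (simp add: semidirect_carrier_iff[OF assms(1,2,5,6)] sym_group_carrier)
  have cent: "centralizer G \<sigma> = centralizer G (0, \<tau>)"
    unfolding assms(7) zs by (rule centralizer_central_mult[OF Gg z s])
  have racks: "rack_type_D (conj_class H \<sigma>') (conj_by H) \<longleftrightarrow>
      rack_type_D (a <#\<^bsub>H\<^esub> conj_class H \<sigma>') (conj_by H)"
    if "group H" "\<sigma>' \<in> carrier H" "a \<in> center H" for H :: "'h monoid" and \<sigma>' a
  proof -
    interpret H: group H by (fact that(1))
    have "conj_class H \<sigma>' \<subseteq> carrier H" using that(2) by (auto simp: conj_class_def conj_by_def)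
    then show ?thesis by (rule rack_type_D_central_translate_iff[OF that(1,3)])
  qed
  have nichols: "(\<chi> \<alpha> = 1 \<longrightarrow>
        (finite_dimensional (class_nichols_algebra G (\<alpha>, \<tau>) W \<rho>) \<longleftrightarrow>
         finite_dimensional (class_nichols_algebra G (0, \<tau>) W \<rho>))) \<and>
      (\<chi> \<alpha> = -1 \<longrightarrow>
        \<not> (finite_dimensional (class_nichols_algebra G (\<alpha>, \<tau>) W \<rho>) \<and>
           finite_dimensional (class_nichols_algebra G (0, \<tau>) W \<rho>)))"
    if "irreducible_rep (char_stabilizer n A \<tau> \<chi>) V \<mu>" and "irreducible_rep (centralizer G \<sigma>) W \<rho>"
      and "rep_iso (centralizer G \<sigma>) W \<rho>
        (theta_space n A \<tau> \<chi> V \<mu>) (ind_act (centralizer G (0, \<tau>)))"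
    for \<chi> and V :: "('i \<Rightarrow> complex) set" and \<mu> and W :: "('j \<Rightarrow> complex) set" and \<rho>
  proof -
    have \<mu>: "representation (char_stabilizer n A \<tau> \<chi>) V \<mu>" using that(1) by (simp add: irreducible_rep_def)
    have \<rho>: "representation (centralizer G (0, \<tau>)) W \<rho>" and W: "W \<noteq> {0}"
      using that(2) by (auto simp: irreducible_rep_def cent)
    have scalar: "\<rho> ?z w = cscale (\<chi> \<alpha>) w" if "w \<in> W" for w
      using all_ones_acts_by_character[OF assms(1,2,5,6) \<alpha> \<mu> \<rho> _ that]
        \<open>rep_iso (centralizer G \<sigma>) W \<rho> (theta_space n A \<tau> \<chi> V \<mu>) _\<close>
      by (simp only: cent assms(3))
    have "class_nichols_algebra G (\<alpha>, \<tau>) W \<rho> = class_nichols_algebra G (0, \<tau>) W \<rho>" if "\<chi> \<alpha> = 1"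
      unfolding zs
      by (rule class_nichols_algebra_central_twist[OF Gg Gf s \<rho> z]) (simp add: scalar that)
    moreover have "\<not> (finite_dimensional (class_nichols_algebra G (\<alpha>, \<tau>) W \<rho>) \<and>
        finite_dimensional (class_nichols_algebra G (0, \<tau>) W \<rho>))" if "\<chi> \<alpha> = - 1"
    proof -
      obtain h where h: "h \<in> carrier G" "conj_by G h (0, \<tau>) = inv\<^bsub>G\<^esub> (0, \<tau>)"
        using permutation_real[OF assms(1,2,5,6)] .
      show ?thesis
        unfolding zs
        by (rule not_both_finite_dimensional[OF Gg Gf s \<rho> W h z zz]) (simp only: scalar that)
    qed
    ultimately show ?thesis by simp
  qed
  show ?thesis
    using cent centralizer_permutation[OF assms(1,2,5,6)] conj_class_central_mult[OF Gg z s]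
      racks nichols
    by (simp only: zs) blast
qed

end
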